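(* There is a constant $C>0$, independent of $\varepsilon$ and $N$, such that whenever the source point (interior mesh point) $(x_m,y_n)$ lies in $\Omega_c$, the discrete Green's function $G_{mn}$ satisfies $$\|G_{mn}\|_{1,\varepsilon}\le CN .$$
   Context: Problem. $\Omega=(-1,1)\times(-1,1)$, $0<\varepsilon\ll 1$, and $a,c$ are sufficiently smooth on $\bar\Omega$. Put $b_1(x,y)=x\,a(x,y)$ and assume $|a(x,y)|\ge\alpha>0$, $|c(x,y)|\ge 0$, $c-\frac12\frac{\partial b_1}{\partial x}\ge\gamma>0$ on $\bar\Omega$, with the standing assumption $\alpha\ge 5/2$. With $(\cdot,\cdot)$ and $\|\cdot\|$ the $L^2(\Omega)$ inner product and norm, $B(u,v)=\varepsilon(\nabla u,\nabla v)+(b_1u_x,v)+(cu,v)$ on $H^1_0(\Omega)$ and $\|v\|_{1,\varepsilon}^2=\varepsilon\|\nabla v\|^2+\|v\|^2$. Mesh. $\beta\in[2/3,1]$, $N\ge4$ is an even integer (divisible by 4 so that the indices below are integers), $\lambda_x=\min\left(\frac{2\varepsilon}{\alpha}\log\frac1\varepsilon,\frac12\right)$, $\lambda_y=\min\left(2\sqrt{\frac{\varepsilon}{\beta}}\log\frac{1}{\varepsilon^{3/2}},\frac14\right)$. In $x$, each of $[0,\lambda_x]$ and $[\lambda_x,1]$ is divided uniformly into $N/2$ intervals, and this is reflected to $[-1,0]$. In $y$, $[-1,-1+\lambda_y]$, $[-1+\lambda_y,1-\lambda_y]$, $[1-\lambda_y,1]$ are divided uniformly into $N/4$, $N/2$,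 $N/4$ intervals. The mesh consists of the tensor-product rectangles. Coarse subregion: $\Omega_c=[\lambda_x,1]\times[-1+\lambda_y,1-\lambda_y]$. $S_h$ is the space of continuous functions on $\bar\Omega$ vanishing on $\partial\Omega$ that are bilinear on each mesh rectangle. For an interior mesh point $(x_m,y_n)$, the discrete Green's function $G_{mn}\in S_h$ is defined by $B(v_h,G_{mn})=v_h(x_m,y_n)$ for all $v_h\in S_h$. *)

theory Defs
  imports "HOL-Analysis.Analysis"
begin

definition Omega :: "(real \<times> real) set" where
  "Omega = {-1<..<1} \<times> {-1<..<1}"

definition C1_on :: "(real \<times> real) set \<Rightarrow> (real \<times> real \<Rightarrow> real) \<Rightarrow> bool" where
  "C1_on S f \<longleftrightarrow>
     (\<exists>f'. (\<forall>z\<in>S. (f has_derivative blinfun_apply (f' z)) (at z within S)) \<and> continuous_on S f')"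

(* Weak derivatives.  Test functions are taken in C^1_c(U); by mollification this gives the same
   weak derivatives as C^infinity_c(U). *)

definition test_functions :: "(real \<times> real) set \<Rightarrow> (real \<times> real \<Rightarrow> real) set" where
  "test_functions U =
     {\<phi>. C1_on UNIV \<phi> \<and> (\<exists>K. compact K \<and> K \<subseteq> U \<and> (\<forall>z. z \<notin> K \<longrightarrow> \<phi> z = 0))}"

definition locally_integrable_on :: "(real \<times> real \<Rightarrow> real) \<Rightarrow> (real \<times> real) set \<Rightarrow> bool" where
  "locally_integrable_on f U \<longleftrightarrow> (\<forall>K. compact K \<and> K \<subseteq> U \<longrightarrow> set_integrable lborel K f)"

definition is_weak_derivative ::
  "(real \<times> real) set \<Rightarrow> real \<times> real \<Rightarrow> (real \<times> real \<Rightarrow> real) \<Rightarrow> (real \<times> real \<Rightarrow> real) \<Rightarrow> bool" where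
  "is_weak_derivative U e u g \<longleftrightarrow>
     locally_integrable_on u U \<and> locally_integrable_on g U \<and>
     (\<forall>\<phi>\<in>test_functions U.
        (LINT z:U|lborel. u z * frechet_derivative \<phi> (at z) e) = - (LINT z:U|lborel. g z * \<phi> z))"

(* A representative of the weak partial derivatives on Omega.  They are determined up to null
   sets, so the integrals below do not depend on the choice. *)

definition wdx :: "(real \<times> real \<Rightarrow> real) \<Rightarrow> real \<times> real \<Rightarrow> real" where
  "wdx u = (SOME g. is_weak_derivative Omega (1, 0) u g)"

definition wdy :: "(real \<times> real \<Rightarrow> real) \<Rightarrow> real \<times> real \<Rightarrow> real" where
  "wdy u = (SOME g. is_weak_derivative Omega (0, 1) u g)"

definition L2_inner :: "(real \<times> real \<Rightarrow> real) \<Rightarrow> (real \<times> real \<Rightarrow> real) \<Rightarrow> real" where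
  "L2_inner f g = (LINT z:Omega|lborel. f z * g z)"

definition grad_inner :: "(real \<times> real \<Rightarrow> real) \<Rightarrow> (real \<times> real \<Rightarrow> real) \<Rightarrow> real" where
  "grad_inner u v = L2_inner (wdx u) (wdx v) + L2_inner (wdy u) (wdy v)"

definition energy_norm :: "real \<Rightarrow> (real \<times> real \<Rightarrow> real) \<Rightarrow> real" where
  "energy_norm \<epsilon> v = sqrt (\<epsilon> * grad_inner v v + L2_inner v v)"

definition b1 :: "(real \<times> real \<Rightarrow> real) \<Rightarrow> real \<times> real \<Rightarrow> real" where
  "b1 a = (\<lambda>(x, y). x * a (x, y))"

(* The classical partial derivative in x on the closure of Omega (one-sided for x = -1, 1). *)

definition pdx :: "(real \<times> real \<Rightarrow> real) \<Rightarrow> real \<times> real \<Rightarrow> real" where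
  "pdx f = (\<lambda>(x, y). vector_derivative (\<lambda>s. f (s, y)) (at x within {-1..1}))"

definition B_form ::
  "real \<Rightarrow> (real \<times> real \<Rightarrow> real) \<Rightarrow> (real \<times> real \<Rightarrow> real) \<Rightarrow>
   (real \<times> real \<Rightarrow> real) \<Rightarrow> (real \<times> real \<Rightarrow> real) \<Rightarrow> real" where
  "B_form \<epsilon> a c u v =
     \<epsilon> * grad_inner u v + L2_inner (\<lambda>z. b1 a z * wdx u z) v + L2_inner (\<lambda>z. c z * u z) v"

definition lambda_x :: "real \<Rightarrow> real \<Rightarrow> real" where
  "lambda_x \<epsilon> \<alpha> = min (2 * \<epsilon> / \<alpha> * ln (1 / \<epsilon>)) (1 / 2)"

definition lambda_y :: "real \<Rightarrow> real \<Rightarrow> real" where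
  "lambda_y \<epsilon> \<beta> = min (2 * sqrt (\<epsilon> / \<beta>) * ln (1 / \<epsilon> powr (3 / 2))) (1 / 4)"

(* The mesh parameter N is divisible by 4.  The x-mesh has the points mesh_x N l i, i = 0..2N
   (i = N is x = 0, and the mesh is symmetric about it), the y-mesh has mesh_y N l j, j = 0..N. *)

definition half_mesh_x :: "nat \<Rightarrow> real \<Rightarrow> nat \<Rightarrow> real" where
  "half_mesh_x N l i =
     (if i \<le> N div 2 then real i * (l / (real N / 2))
      else l + (real i - real N / 2) * ((1 - l) / (real N / 2)))"

definition mesh_x :: "nat \<Rightarrow> real \<Rightarrow> nat \<Rightarrow> real" where
  "mesh_x N l i = (if N \<le> i then half_mesh_x N l (i - N) else - half_mesh_x N l (N - i))"

definition mesh_y :: "nat \<Rightarrow> real \<Rightarrow> nat \<Rightarrow> real" where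
  "mesh_y N l j =
     (if j \<le> N div 4 then - 1 + real j * (l / (real N / 4))
      else if j \<le> 3 * N div 4 then - 1 + l + (real j - real N / 4) * ((2 - 2 * l) / (real N / 2))
      else 1 - l + (real j - 3 * real N / 4) * (l / (real N / 4)))"

definition mesh_rect :: "nat \<Rightarrow> real \<Rightarrow> real \<Rightarrow> nat \<Rightarrow> nat \<Rightarrow> (real \<times> real) set" where
  "mesh_rect N lx ly i j =
     {mesh_x N lx i .. mesh_x N lx (Suc i)} \<times> {mesh_y N ly j .. mesh_y N ly (Suc j)}"

definition bilinear_on :: "(real \<times> real) set \<Rightarrow> (real \<times> real \<Rightarrow> real) \<Rightarrow> bool" where
  "bilinear_on R v \<longleftrightarrow>
     (\<exists>p q r s. \<forall>(x, y)\<in>R. v (x, y) = p + q * x + r * y + s * x * y)"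

(* Members of S_h are functions on the closure of Omega; their values elsewhere are left
   arbitrary and enter none of the notions used here. *)

definition S_h :: "nat \<Rightarrow> real \<Rightarrow> real \<Rightarrow> (real \<times> real \<Rightarrow> real) set" where
  "S_h N lx ly =
     {v. continuous_on (closure Omega) v \<and> (\<forall>z\<in>frontier Omega. v z = 0) \<and>
         (\<forall>i<2 * N. \<forall>j<N. bilinear_on (mesh_rect N lx ly i j) v)}"

definition Omega_c :: "real \<Rightarrow> real \<Rightarrow> (real \<times> real) set" where
  "Omega_c lx ly = {lx .. 1} \<times> {- 1 + ly .. 1 - ly}"

definition is_discrete_Green ::
  "real \<Rightarrow> (real \<times> real \<Rightarrow> real) \<Rightarrow> (real \<times> real \<Rightarrow> real) \<Rightarrow> nat \<Rightarrow> real \<Rightarrow> real \<Rightarrow>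
   real \<times> real \<Rightarrow> (real \<times> real \<Rightarrow> real) \<Rightarrow> bool" where
  "is_discrete_Green \<epsilon> a c N lx ly p G \<longleftrightarrow>
     G \<in> S_h N lx ly \<and> (\<forall>v\<in>S_h N lx ly. B_form \<epsilon> a c v G = v p)"

end

theory Submission
  imports Defs
begin

text \<open>
  Integrating the convection term by parts gives the coercivity
  \<open>min 1 \<gamma> * \<parallel>G\<parallel>\<^sup>2 \<le> B(G, G) = G(x\<^sub>m, y\<^sub>n)\<close> in the energy norm.  A source point in the coarse region is
  a corner of a coarse mesh rectangle \<open>T\<close> of area at least \<open>1 / N\<^sup>2\<close>, and for a bilinear function the
  square of a corner value is at most \<open>16 / |T|\<close> times the integral of its square over \<open>T\<close>.  Hence
  \<open>G(x\<^sub>m, y\<^sub>n) \<le> 4 * N * \<parallel>G\<parallel>\<close>, so that \<open>\<parallel>G\<parallel> \<le> 4 / min 1 \<gamma> * N\<close>.  The \<open>y\<close>-derivative enters only through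
  the nonnegative number \<open>L2_inner (wdy G) (wdy G)\<close>, so nothing has to be known about it.
\<close>

subsection \<open>Uniqueness of weak derivatives\<close>

text \<open>The obstacle is that \<open>wdx\<close> is picked by \<open>SOME\<close>: the pointwise
  derivative of the piecewise bilinear \<open>G\<close> says nothing about it directly. Two facts
  bridge the gap: the piecewise derivative is a weak derivative, and weak derivatives agree almost
  everywhere on \<open>Omega\<close>. The second is obtained without mollification, from C^1
  functions that converge boundedly to indicators of rectangles. Integration by parts produces no
  jump terms across mesh lines: \<open>G\<close> is continuous, and the fundamental theorem of
  calculus on a horizontal line tolerates finitely many exceptional points. The area bound 1 / N^2
  holds because the transition points are capped at 1/2 and 1/4. The coarse widths (1 - lx) / (N/2)
  and (2 - 2 ly) / (N/2) are then at least 1 / N whatever \<epsilon> is, so the final constant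
  depends on \<gamma> alone. The factor 16 is a factor 4 for each of the two variables.\<close>

lemma AE_eq_0_if_box_integrals_eq_0:
  fixes f :: "'a::euclidean_space \<Rightarrow> real"
  assumes f: "integrable lborel f" and box: "\<And>a b. (LINT x:box a b|lborel. f x) = 0"
  shows "AE x in lborel. f x = 0"
proof (rule sigma_finite_measure.density_zero[OF sigma_finite_lborel f])
  have si: "set_integrable lborel A f" if "A \<in> sets borel" for A
    using f that unfolding set_integrable_def by (intro integrable_mult_indicator) auto
  \<comment> \<open>The complement case of the induction below needs the integral over the whole
    space; it is the limit of the vanishing integrals over growing boxes.\<close>
  have univ: "(LINT x|lborel. f x) = 0"
  proof -
    let ?A = "\<lambda>n::nat. box (- (real n *\<^sub>R One)) (real n *\<^sub>R One) :: 'a set"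
    have "(\<lambda>n. LINT x:?A n|lborel. f x) \<longlonglongrightarrow> (LINT x:(\<Union>n. ?A n)|lborel. f x)"
    proof (rule set_integral_cont_up)
      show "incseq ?A"
        by (auto simp: incseq_def subset_box)
    qed (auto intro!: si)
    moreover have "(\<Union>n. ?A n) = UNIV"
      using UN_box_eq_UNIV by auto
    ultimately have "(\<lambda>n. LINT x:?A n|lborel. f x) \<longlonglongrightarrow> (LINT x:UNIV|lborel. f x)" by simp
    then have "(LINT x:UNIV|lborel. f x) = 0" unfolding box LIMSEQ_const_iff by simp
    then show ?thesis by (simp add: set_lebesgue_integral_def)
  qed
  \<comment> \<open>Dynkin's argument: boxes are stable under intersection and generate the Borel
    sets, so vanishing integrals pass from boxes to every Borel set.\<close>
  fix A :: "'a set" assume "A \<in> sets lborel"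
  then have A: "A \<in> sigma_sets UNIV (range (\<lambda>(a, b). box a b))"
    by (simp add: borel_eq_box)
  have stable: "Int_stable (range (\<lambda>(a, b::'a). box a b))"
    by (auto simp: Int_stable_def box_Int_box)
  have "range (\<lambda>(a, b::'a). box a b) \<subseteq> Pow UNIV" by simp
  from stable this A show "set_lebesgue_integral lborel A f = 0"
  proof (induction rule: sigma_sets_induct_disjoint)
    case (compl A)
    then have A: "A \<in> sets borel" by (simp add: borel_eq_box)
    have "(LINT x:A \<union> (UNIV - A)|lborel. f x)
        = (LINT x:A|lborel. f x) + (LINT x:UNIV - A|lborel. f x)"
      using A by (intro set_integral_Un si) auto
    with compl univ show ?case by (simp add: set_lebesgue_integral_def)
  next
    case (union A)
    then have A: "A i \<in> sets borel" for i by (auto simp: borel_eq_box)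
    have "(LINT x:(\<Union>i. A i)|lborel. f x) = (\<Sum>i. LINT x:A i|lborel. f x)"
      using A union(1) by (intro lebesgue_integral_countable_add si) (auto simp: disjoint_family_on_def)
    with union show ?case by simp
  next
    case empty
    show ?case by (simp add: set_lebesgue_integral_def)
  qed (auto simp: box)
qed

section \<open>C^1 test functions approximating indicators of rectangles\<close>

lemma C1_on_imp_continuous_on:
  assumes "C1_on S f"
  shows "continuous_on S f"
proof -
  obtain f' where "\<And>z. z \<in> S \<Longrightarrow> (f has_derivative blinfun_apply (f' z)) (at z within S)"
    using assms by (auto simp: C1_on_def)
  then show ?thesis by (rule has_derivative_continuous_on)
qed

text \<open>The derivative is a combination of the two fixed functionals \<open>Blinfun fst\<close>
  and \<open>Blinfun snd\<close>, so its continuity reduces to that of the partial derivatives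
  \<open>p\<close> and \<open>q\<close>.\<close>

lemma C1_on_UNIV_I:
  assumes "\<And>z. (f has_derivative (\<lambda>h. p z * fst h + q z * snd h)) (at z)"
    and "continuous_on UNIV p" "continuous_on UNIV q"
  shows "C1_on UNIV f"
  unfolding C1_on_def
proof (intro exI conjI ballI)
  let ?f' = "\<lambda>z. p z *\<^sub>R Blinfun fst + q z *\<^sub>R Blinfun snd :: (real \<times> real) \<Rightarrow>\<^sub>L real"
  show "continuous_on UNIV ?f'"
    using assms by (intro continuous_intros)
  have "blinfun_apply (?f' z) = (\<lambda>h. p z * fst h + q z * snd h)" for z
    by (rule ext) (simp add: blinfun.add_left blinfun.scaleR_left bounded_linear_Blinfun_apply bounded_linear_fst bounded_linear_snd)
  then show "(f has_derivative blinfun_apply (?f' z)) (at z within UNIV)" for z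
    using assms(1) by simp
qed

text \<open>Squaring flattens the kink of the positive part: the difference quotient at 0 is
  \<open>max 0 h\<close>, which tends to 0.\<close>

lemma DERIV_max_0_square: "((\<lambda>t::real. (max 0 t)\<^sup>2) has_real_derivative 2 * max 0 t) (at t)"
proof -
  consider "t < 0" | "t = 0" | "t > 0" by linarith
  then show ?thesis
  proof cases
    case 1
    have "((\<lambda>t::real. 0) has_real_derivative 2 * max 0 t) (at t)" using 1 by simp
    then show ?thesis
      by (rule has_field_derivative_transform_within_open[where S="{..<0}"]) (use 1 in auto)
  next
    case 2
    have "((\<lambda>h::real. max 0 h) \<longlongrightarrow> max 0 0) (at 0)" by (intro tendsto_intros)
    then have "((\<lambda>h::real. max 0 h) \<longlongrightarrow> 0) (at 0)" by simp
    moreover have "(max 0 h)\<^sup>2 / h = max 0 h" if "h \<noteq> 0" for h :: real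
      using that by (auto simp: max_def power2_eq_square)
    ultimately have "((\<lambda>h::real. (max 0 h)\<^sup>2 / h) \<longlongrightarrow> 0) (at 0)"
      by (subst tendsto_cong[where g="max 0"]) (auto simp: eventually_at_filter)
    then show ?thesis using 2 by (simp add: DERIV_def)
  next
    case 3
    have "((\<lambda>t::real. t\<^sup>2) has_real_derivative 2 * max 0 t) (at t)"
      using 3 by (auto intro!: derivative_eq_intros)
    then show ?thesis
      by (rule has_field_derivative_transform_within_open[where S="{0<..}"]) (use 3 in auto)
  qed
qed

text \<open>The squared positive part of the parabola with zeros \<open>a\<close> and
  \<open>b\<close>. Test functions only have to be C^1 here, so this piecewise polynomial takes the
  place of the usual exponential bump.\<close>

definition bump :: "real \<Rightarrow> real \<Rightarrow> real \<Rightarrow> real" where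
  "bump a b t = (max 0 ((t - a) * (b - t)))\<^sup>2"

lemma DERIV_bump:
  "(bump a b has_real_derivative 2 * max 0 ((t - a) * (b - t)) * (a + b - 2 * t)) (at t)"
proof -
  have "((\<lambda>t. (t - a) * (b - t)) has_real_derivative (a + b - 2 * t)) (at t)"
    by (auto intro!: derivative_eq_intros simp: algebra_simps)
  from DERIV_chain2[OF DERIV_max_0_square this] show ?thesis
    by (simp add: bump_def[abs_def])
qed

lemma bump_pos: "a < b \<Longrightarrow> 0 < bump a b t \<longleftrightarrow> t \<in> {a<..<b}"
  by (auto simp: bump_def max_def zero_less_mult_iff mult_le_0_iff zero_le_mult_iff mult_less_0_iff)

lemma bump_nonneg: "0 \<le> bump a b t"
  by (simp add: bump_def)

text \<open>Completing the square puts the maximum ((b - a) / 2)^2 of the parabola at the midpoint.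
  Subintervals of (-1, 1) have length at most 2, so the base 1 - \<psi> of the powers in
  \<open>box_test\<close> stays in [0, 1].\<close>

lemma bump_le_1: assumes "b - a \<le> 2" "a < b" shows "bump a b t \<le> 1"
proof -
  have "(t - a) * (b - t) = ((b - a) / 2)\<^sup>2 - (t - (a + b) / 2)\<^sup>2"
    by (simp add: power2_eq_square field_simps)
  also have "\<dots> \<le> ((b - a) / 2)\<^sup>2" by simp
  also have "\<dots> \<le> 1\<^sup>2" using assms by (intro power_mono) auto
  finally have "max 0 ((t - a) * (b - t)) \<le> 1" by simp
  then show ?thesis by (simp add: bump_def power_le_one)
qed

text \<open>With \<open>\<psi>\<close> the product bump, taking values in \<open>[0, 1]\<close> and positive exactly on the open rectangle,
  the functions \<open>1 - (1 - \<psi>) ^ k\<close> converge boundedly to the indicator of that rectangle.\<close>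

definition box_test :: "real \<Rightarrow> real \<Rightarrow> real \<Rightarrow> real \<Rightarrow> nat \<Rightarrow> real \<times> real \<Rightarrow> real" where
  "box_test a b c d k z = 1 - (1 - bump a b (fst z) * bump c d (snd z)) ^ k"

lemma C1_on_box_test: "C1_on UNIV (box_test a b c d k)"
proof -
  let ?D = "\<lambda>a b t::real. 2 * max 0 ((t - a) * (b - t)) * (a + b - 2 * t)"
  \<comment> \<open>Outer factor of the chain rule. For \<open>k = 0\<close> the truncated exponent
    \<open>k - 1\<close> does no harm, since the factor \<open>real k\<close> vanishes.\<close>
  let ?w = "\<lambda>z. real k * (1 - bump a b (fst z) * bump c d (snd z)) ^ (k - 1)"
  have contb: "continuous_on UNIV (bump a b)" for a b
    using DERIV_bump DERIV_isCont by (metis continuous_at_imp_continuous_on)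
  note [continuous_intros] = continuous_on_compose2[OF contb]
  show ?thesis
  proof (rule C1_on_UNIV_I)
    fix z :: "real \<times> real"
    have 1: "((\<lambda>z. bump a b (fst z)) has_derivative (\<lambda>h. ?D a b (fst z) * fst h)) (at z)"
      using has_derivative_compose[OF has_derivative_fst[OF has_derivative_ident]
          DERIV_bump[of a b "fst z", unfolded has_field_derivative_def]] by simp
    have 2: "((\<lambda>z. bump c d (snd z)) has_derivative (\<lambda>h. ?D c d (snd z) * snd h)) (at z)"
      using has_derivative_compose[OF has_derivative_snd[OF has_derivative_ident]
          DERIV_bump[of c d "snd z", unfolded has_field_derivative_def]] by simp
    show "(box_test a b c d k has_derivative
       (\<lambda>h. (?w z * (?D a b (fst z) * bump c d (snd z))) * fst h
          + (?w z * (?D c d (snd z) * bump a b (fst z))) * snd h)) (at z)"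
      unfolding box_test_def[abs_def]
      by (rule derivative_eq_intros 1 2 refl)+ (auto simp: algebra_simps)
  qed (intro continuous_intros; simp)+
qed

lemma box_test_eq_0:
  assumes "a < b" "c < d" "z \<notin> {a<..<b} \<times> {c<..<d}"
  shows "box_test a b c d k z = 0"
proof -
  have "\<not> 0 < bump a b (fst z) \<or> \<not> 0 < bump c d (snd z)"
    using bump_pos assms by (cases z) auto
  then have "bump a b (fst z) * bump c d (snd z) = 0"
    using bump_nonneg by (metis less_eq_real_def mult_eq_0_iff)
  then show ?thesis by (simp only: box_test_def) simp
qed

lemma box_test_in_test_functions:
  assumes "-1 < a" "a < b" "b < 1" "-1 < c" "c < d" "d < 1"
  shows "box_test a b c d k \<in> test_functions Omega"
proof -
  have "compact ({a..b} \<times> {c..d})" by (intro compact_Times compact_Icc)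
  moreover have "{a..b} \<times> {c..d} \<subseteq> Omega" using assms by (auto simp: Omega_def)
  moreover have "box_test a b c d k z = 0" if "z \<notin> {a..b} \<times> {c..d}" for z
    using assms that by (intro box_test_eq_0) auto
  ultimately show ?thesis
    using C1_on_box_test by (auto simp: test_functions_def)
qed

lemma box_test_limit:
  assumes "-1 < a" "a < b" "b < 1" "-1 < c" "c < d" "d < 1"
  shows "(\<lambda>k. box_test a b c d k z) \<longlonglongrightarrow> indicator ({a<..<b} \<times> {c<..<d}) z"
    and "\<bar>box_test a b c d k z\<bar> \<le> 1"
proof -
  let ?p = "bump a b (fst z) * bump c d (snd z)"
  have p: "0 \<le> ?p" "?p \<le> 1"
    using assms bump_nonneg bump_le_1 by (auto intro!: mult_le_one)
  then show "\<bar>box_test a b c d k z\<bar> \<le> 1"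
    using power_le_one[of "1 - ?p" k] zero_le_power[of "1 - ?p" k] by (simp add: box_test_def)
  show "(\<lambda>k. box_test a b c d k z) \<longlonglongrightarrow> indicator ({a<..<b} \<times> {c<..<d}) z"
  proof (cases "z \<in> {a<..<b} \<times> {c<..<d}")
    case True
    then have "0 < ?p" using bump_pos assms by (cases z) auto
    then have "(\<lambda>k. (1 - ?p) ^ k) \<longlonglongrightarrow> 0" using p by (intro LIMSEQ_power_zero) auto
    from tendsto_diff[OF tendsto_const[of 1] this] True show ?thesis
      by (simp add: box_test_def)
  next
    case False
    then show ?thesis using box_test_eq_0[of a b c d z] assms by simp
  qed
qed

section \<open>Topology of \<open>Omega\<close> and integrability of products on it\<close>

lemma Omega_eq_box: "Omega = box (-1, -1) (1, 1)"
  by (auto simp: Omega_def box_def Basis_prod_def)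

lemma closure_Omega: "closure Omega = {-1..1} \<times> {-1..1}"
  by (simp add: Omega_def closure_Times)

lemma closure_Omega_cbox: "closure Omega = cbox (-1, -1) (1, 1)"
  by (auto simp: closure_Omega cbox_Pair_eq)

lemma open_Omega: "open Omega"
  unfolding Omega_eq_box by (rule open_box)

lemma sets_Omega [measurable]: "Omega \<in> sets borel"
  by (simp add: open_Omega)

lemma Omega_subset_closure: "Omega \<subseteq> closure Omega"
  by (rule closure_subset)

lemma frontier_OmegaI: "\<bar>x\<bar> = 1 \<Longrightarrow> \<bar>y\<bar> \<le> 1 \<Longrightarrow> (x, y) \<in> frontier Omega"
  using open_Omega by (auto simp: frontier_def interior_open closure_Omega) (auto simp: Omega_def)

lemma set_integrable_continuous_closure_Omega:
  fixes f :: "real \<times> real \<Rightarrow> real"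
  assumes "continuous_on (closure Omega) f"
  shows "set_integrable lborel Omega f"
proof (rule set_integrable_subset)
  show "set_integrable lborel (closure Omega) f"
    unfolding set_integrable_def using assms
    by (intro borel_integrable_compact) (auto simp: closure_Omega_cbox)
qed (use Omega_subset_closure in auto)

text \<open>Meant for \<open>g\<close> a piecewise derivative, which is bounded and measurable but
  not continuous; \<open>M * f\<close> is the integrable majorant.\<close>

lemma set_integrable_continuous_mult_bounded:
  fixes f g :: "real \<times> real \<Rightarrow> real"
  assumes f: "continuous_on (closure Omega) f"
    and g: "set_borel_measurable lborel Omega g" "\<And>z. z \<in> Omega \<Longrightarrow> \<bar>g z\<bar> \<le> M"
  shows "set_integrable lborel Omega (\<lambda>z. g z * f z)"
proof (rule set_integrable_bound)
  show "set_integrable lborel Omega (\<lambda>z. M * f z)"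
    using f by (intro set_integrable_continuous_closure_Omega continuous_intros)
  have "(\<lambda>z. indicat_real Omega z *\<^sub>R f z) \<in> borel_measurable lborel"
    using set_integrable_continuous_closure_Omega[OF f]
    by (auto simp: set_integrable_def)
  then have "(\<lambda>z. (indicat_real Omega z *\<^sub>R g z) * (indicat_real Omega z *\<^sub>R f z)) \<in> borel_measurable lborel"
    using g(1) unfolding set_borel_measurable_def by (rule borel_measurable_times[rotated])
  also have "(\<lambda>z. (indicat_real Omega z *\<^sub>R g z) * (indicat_real Omega z *\<^sub>R f z))
      = (\<lambda>z. indicat_real Omega z *\<^sub>R (g z * f z))"
    by (auto simp: indicator_def)
  finally show "set_borel_measurable lborel Omega (\<lambda>z. g z * f z)"
    by (simp add: set_borel_measurable_def)
  show "AE z in lborel. z \<in> Omega \<longrightarrow> norm (g z * f z) \<le> norm (M * f z)"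
  proof (intro AE_I2 impI)
    fix z assume "z \<in> Omega"
    from g(2)[OF this] have "\<bar>g z\<bar> \<le> \<bar>M\<bar>" by linarith
    then show "norm (g z * f z) \<le> norm (M * f z)"
      by (simp add: abs_mult mult_right_mono)
  qed
qed

lemma test_functions_C1:
  assumes "\<phi> \<in> test_functions U"
  obtains f' where "\<And>z. (\<phi> has_derivative blinfun_apply (f' z)) (at z)" "continuous_on UNIV f'"
    "\<And>z e. frechet_derivative \<phi> (at z) e = blinfun_apply (f' z) e"
proof -
  obtain f' where 1: "\<And>z. (\<phi> has_derivative blinfun_apply (f' z)) (at z)" "continuous_on UNIV f'"
    using assms by (auto simp: test_functions_def C1_on_def)
  from frechet_derivative_at[OF 1(1)] have "\<And>z e. frechet_derivative \<phi> (at z) e = blinfun_apply (f' z) e"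
    by metis
  with 1 that show ?thesis by blast
qed

lemma test_functions_continuous: "\<phi> \<in> test_functions U \<Longrightarrow> continuous_on S \<phi>"
  by (metis test_functions_C1 has_derivative_continuous continuous_at_imp_continuous_on)

text \<open>A test function is bounded and lives on a compact \<open>K\<close>, where
  \<open>g\<close> is integrable. This makes the integrals in the weak identity genuine, so that two
  such identities may be subtracted.\<close>

lemma integrable_mult_test_function:
  assumes g: "locally_integrable_on g U" and \<phi>: "\<phi> \<in> test_functions U"
  shows "set_integrable lborel U (\<lambda>z. g z * \<phi> z)"
proof -
  obtain K where K: "compact K" "K \<subseteq> U" "\<And>z. z \<notin> K \<Longrightarrow> \<phi> z = 0"
    using \<phi> by (auto simp: test_functions_def)
  have int: "integrable lborel (\<lambda>z. indicat_real K z *\<^sub>R g z)"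
    using g K by (auto simp: locally_integrable_on_def set_integrable_def)
  have "bounded (\<phi> ` K)"
    using K(1) test_functions_continuous[OF \<phi>] by (intro compact_imp_bounded compact_continuous_image)
  then obtain M where M: "\<And>z. z \<in> K \<Longrightarrow> \<bar>\<phi> z\<bar> \<le> M"
    by (auto simp: bounded_iff)
  have [measurable]: "\<phi> \<in> borel_measurable borel"
    using test_functions_continuous[OF \<phi>] by (rule borel_measurable_continuous_onI)
  have "integrable lborel (\<lambda>z. (indicat_real K z *\<^sub>R g z) * \<phi> z)"
  proof (rule Bochner_Integration.integrable_bound[OF integrable_mult_left[OF int, of M]])
    show "(\<lambda>z. (indicat_real K z *\<^sub>R g z) * \<phi> z) \<in> borel_measurable lborel"
      using int by measurable
    show "AE z in lborel. norm (indicat_real K z *\<^sub>R g z * \<phi> z) \<le> norm (indicat_real K z *\<^sub>R g z * M)"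
    proof (rule AE_I2)
      fix z
      show "norm (indicat_real K z *\<^sub>R g z * \<phi> z) \<le> norm (indicat_real K z *\<^sub>R g z * M)"
        using M[of z] by (auto simp: indicator_def abs_mult intro!: mult_left_mono)
    qed
  qed
  also have "(\<lambda>z. (indicat_real K z *\<^sub>R g z) * \<phi> z) = (\<lambda>z. indicat_real U z *\<^sub>R (g z * \<phi> z))"
    using K(2,3) by (fastforce simp: indicator_def)
  finally show ?thesis by (simp add: set_integrable_def)
qed

text \<open>Tested against \<open>box_test\<close>, both weak derivatives yield the same integral
  involving \<open>u\<close>, so their difference is orthogonal to every
  \<open>box_test a b c d k\<close>. Letting \<open>k\<close> grow, dominated convergence replaces
  the test function by the indicator. The closed rectangle \<open>?C\<close> is compact in
  \<open>Omega\<close>, hence the difference is integrable there and supplies the majorant.\<close>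

lemma rectangle_integrals_weak_derivative_unique:
  assumes g: "is_weak_derivative Omega e u g1" "is_weak_derivative Omega e u g2"
    and r: "-1 < a" "a < b" "b < 1" "-1 < c" "c < d" "d < 1"
  shows "(LINT z:{a<..<b} \<times> {c<..<d}|lborel. g1 z - g2 z) = 0"
proof -
  let ?R = "{a<..<b} \<times> {c<..<d}" and ?h = "\<lambda>z. g1 z - g2 z" and ?C = "{a..b} \<times> {c..d}"
  let ?t = "box_test a b c d"
  have loc: "locally_integrable_on g1 Omega" "locally_integrable_on g2 Omega"
    using g by (auto simp: is_weak_derivative_def)
  have C: "compact ?C" "?C \<subseteq> Omega"
    using r by (auto simp: Omega_def intro: compact_Times)
  then have int: "set_integrable lborel ?C ?h"
    using loc by (intro set_integral_diff) (auto simp: locally_integrable_on_def)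
  then have [measurable]: "(\<lambda>z. indicat_real ?C z *\<^sub>R ?h z) \<in> borel_measurable lborel"
    unfolding set_integrable_def by (rule borel_measurable_integrable)
  have [measurable]: "?R \<in> sets lborel" by (simp add: open_Times)
  have test: "?t k \<in> test_functions Omega" for k
    using r by (rule box_test_in_test_functions)
  have tm[measurable]: "?t k \<in> borel_measurable borel" for k
    using test_functions_continuous[OF test] by (rule borel_measurable_continuous_onI)
  have t0: "?t k z = 0" if "z \<notin> ?C" for k z
    using r that by (intro box_test_eq_0) auto
  have "(LINT z|lborel. (indicat_real ?C z *\<^sub>R ?h z) * ?t k z) = 0" for k
  proof -
    have "(LINT z:Omega|lborel. g1 z * ?t k z) = (LINT z:Omega|lborel. g2 z * ?t k z)"
    proof -
      have "(LINT z:Omega|lborel. u z * frechet_derivative (?t k) (at z) e) = - (LINT z:Omega|lborel. g1 z * ?t k z)"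
        using g(1) test[of k] unfolding is_weak_derivative_def by blast
      moreover have "(LINT z:Omega|lborel. u z * frechet_derivative (?t k) (at z) e) = - (LINT z:Omega|lborel. g2 z * ?t k z)"
        using g(2) test[of k] unfolding is_weak_derivative_def by blast
      ultimately show ?thesis by linarith
    qed
    then have "(LINT z:Omega|lborel. g1 z * ?t k z - g2 z * ?t k z) = 0"
      using loc test[of k] by (simp add: set_integral_diff integrable_mult_test_function)
    also have "(LINT z:Omega|lborel. g1 z * ?t k z - g2 z * ?t k z)
      = (LINT z|lborel. (indicat_real ?C z *\<^sub>R ?h z) * ?t k z)"
      unfolding set_lebesgue_integral_def
      using t0[of _ k] C(2) by (intro Bochner_Integration.integral_cong refl)
        (auto simp: indicator_def algebra_simps)
    finally show ?thesis .
  qed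
  moreover have "(\<lambda>k. LINT z|lborel. (indicat_real ?C z *\<^sub>R ?h z) * ?t k z)
     \<longlonglongrightarrow> (LINT z|lborel. (indicat_real ?C z *\<^sub>R ?h z) * indicator ?R z)"
  proof (rule integral_dominated_convergence)
    show "integrable lborel (\<lambda>z. norm (indicat_real ?C z *\<^sub>R ?h z))"
      using int unfolding set_integrable_def by (rule integrable_norm)
    show "AE z in lborel. (\<lambda>k. (indicat_real ?C z *\<^sub>R ?h z) * ?t k z)
       \<longlonglongrightarrow> (indicat_real ?C z *\<^sub>R ?h z) * indicator ?R z"
      using box_test_limit(1)[OF r] by (intro AE_I2 tendsto_intros)
    show "AE z in lborel. norm ((indicat_real ?C z *\<^sub>R ?h z) * ?t k z) \<le> norm (indicat_real ?C z *\<^sub>R ?h z)" for k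
      using box_test_limit(2)[OF r] by (intro AE_I2) (auto simp: abs_mult intro!: mult_left_le)
    show "(\<lambda>z. (indicat_real ?C z *\<^sub>R ?h z) * indicator ?R z) \<in> borel_measurable lborel"
      by (rule borel_measurable_times) measurable
    show "(\<lambda>z. (indicat_real ?C z *\<^sub>R ?h z) * ?t k z) \<in> borel_measurable lborel" for k
      by (rule borel_measurable_times) measurable
  qed
  ultimately have "(LINT z|lborel. (indicat_real ?C z *\<^sub>R ?h z) * indicator ?R z) = 0"
    by (simp add: LIMSEQ_const_iff)
  also have "(\<lambda>z. (indicat_real ?C z *\<^sub>R ?h z) * indicator ?R z) = (\<lambda>z. indicator ?R z *\<^sub>R ?h z)"
    by (auto simp: indicator_def)
  finally show ?thesis by (simp add: set_lebesgue_integral_def)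
qed

lemma open_box_eq_rectangle: "box a b = {fst a<..<fst b} \<times> {snd a<..<snd b}" for a b :: "real \<times> real"
  by (cases a; cases b) (auto simp: box_def Basis_prod_def)

text \<open>Local integrability controls the difference only away from the boundary. The criterion
  on boxes is therefore applied to its truncation to the square of half-width \<open>r < 1\<close>,
  and countably many such squares exhaust \<open>Omega\<close>.\<close>

lemma weak_derivative_unique_AE:
  assumes g: "is_weak_derivative Omega e u g1" "is_weak_derivative Omega e u g2"
  shows "AE z in lborel. z \<in> Omega \<longrightarrow> g1 z = g2 z"
proof -
  let ?h = "\<lambda>z. g1 z - g2 z"
  let ?S = "\<lambda>r::real. {-r<..<r} \<times> {-r<..<r}"
  have *: "AE z in lborel. indicator (?S r) z *\<^sub>R ?h z = 0" if r: "0 < r" "r < 1" for r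
  proof (rule AE_eq_0_if_box_integrals_eq_0)
    have loc: "locally_integrable_on g1 Omega" "locally_integrable_on g2 Omega"
      using g by (auto simp: is_weak_derivative_def)
    have "compact ({-r..r} \<times> {-r..r})" "{-r..r} \<times> {-r..r} \<subseteq> Omega"
      using r by (auto simp: Omega_def intro: compact_Times)
    then have "set_integrable lborel ({-r..r} \<times> {-r..r}) ?h"
      using loc by (intro set_integral_diff) (auto simp: locally_integrable_on_def)
    then have "set_integrable lborel (?S r) ?h"
      by (rule set_integrable_subset) (auto simp: borel_Times)
    then show "integrable lborel (\<lambda>z. indicator (?S r) z *\<^sub>R ?h z)"
      by (simp add: set_integrable_def)
    fix p q :: "real \<times> real"
    \<comment> \<open>The intersection of the box with the square is again a rectangle, with clipped
      end points; it may be empty.\<close>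
    define a where "a = max (fst p) (-r)"
    define b where "b = min (fst q) r"
    define c where "c = max (snd p) (-r)"
    define d where "d = min (snd q) r"
    have "(LINT z:box p q|lborel. indicator (?S r) z *\<^sub>R ?h z) = (LINT z:{a<..<b} \<times> {c<..<d}|lborel. ?h z)"
      unfolding set_lebesgue_integral_def open_box_eq_rectangle
      by (intro Bochner_Integration.integral_cong refl)
         (auto simp: indicator_def a_def b_def c_def d_def)
    also have "\<dots> = 0"
    proof (cases "a < b \<and> c < d")
      case True
      then show ?thesis
        using r by (intro rectangle_integrals_weak_derivative_unique[OF g])
          (auto simp: a_def b_def c_def d_def)
    next
      case False
      then have e: "{a<..<b} \<times> {c<..<d} = {}" by auto
      show ?thesis unfolding e by (simp add: set_lebesgue_integral_def)
    qed
    finally show "(LINT z:box p q|lborel. indicator (?S r) z *\<^sub>R ?h z) = 0" .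
  qed
  \<comment> \<open>The shift \<open>n + 2\<close> keeps all half-widths strictly between 0 and 1,
    starting at 1/2.\<close>
  have "AE z in lborel. \<forall>n. indicator (?S (1 - 1 / real (n + 2))) z *\<^sub>R ?h z = 0"
    unfolding AE_all_countable by (intro allI *) auto
  then show ?thesis
  proof eventually_elim
    case (elim z)
    show "z \<in> Omega \<longrightarrow> g1 z = g2 z"
    proof
      assume "z \<in> Omega"
      then have "max \<bar>fst z\<bar> \<bar>snd z\<bar> < 1" by (auto simp: Omega_def)
      then obtain n where n: "inverse (real (Suc n)) < 1 - max \<bar>fst z\<bar> \<bar>snd z\<bar>"
        using reals_Archimedean[of "1 - max \<bar>fst z\<bar> \<bar>snd z\<bar>"] by auto
      have "1 / real (n + 2) \<le> inverse (real (Suc n))" by (simp add: field_simps)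
      with n have "max \<bar>fst z\<bar> \<bar>snd z\<bar> < 1 - 1 / real (n + 2)" by linarith
      then have "\<bar>fst z\<bar> < 1 - 1 / real (n + 2)" "\<bar>snd z\<bar> < 1 - 1 / real (n + 2)" by linarith+
      then have "z \<in> ?S (1 - 1 / real (n + 2))" by (cases z) auto
      with elim[rule_format, of n] show "g1 z = g2 z" by simp
    qed
  qed
qed

text \<open>On \<open>Omega\<close>, \<open>g\<close> is the pointwise limit of its truncations to
  growing compact squares, each measurable because integrable. For \<open>wdx G\<close>, known only
  through its defining property, this is the source of measurability.\<close>

lemma locally_integrable_on_Omega_measurable:
  assumes "locally_integrable_on g Omega"
  shows "set_borel_measurable lborel Omega g"
  unfolding set_borel_measurable_def
proof (rule borel_measurable_LIMSEQ_real)
  let ?K = "\<lambda>n::nat. {-(1 - 1 / real (n + 2))..1 - 1 / real (n + 2)} \<times> {-(1 - 1 / real (n + 2))..1 - 1 / real (n + 2)}"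
  show "(\<lambda>z. indicat_real (?K n) z *\<^sub>R g z) \<in> borel_measurable lborel" for n
  proof -
    have "{-r..r} \<times> {-r..r} \<subseteq> Omega" if "r < 1" for r
      using that by (auto simp: Omega_def)
    from this[of "1 - 1 / real (n + 2)"] have "compact (?K n)" "?K n \<subseteq> Omega"
      by (simp_all add: compact_Times del: of_nat_add)
    then have "set_integrable lborel (?K n) g"
      using assms by (auto simp: locally_integrable_on_def)
    then show ?thesis unfolding set_integrable_def by (rule borel_measurable_integrable)
  qed
  show "(\<lambda>n. indicat_real (?K n) z *\<^sub>R g z) \<longlonglongrightarrow> indicat_real Omega z *\<^sub>R g z" for z
  proof (cases "z \<in> Omega")
    case True
    then have "max \<bar>fst z\<bar> \<bar>snd z\<bar> < 1" by (auto simp: Omega_def)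
    moreover have "(\<lambda>n. 1 - 1 / real (n + 2)) \<longlonglongrightarrow> 1 - 0"
      by (intro tendsto_intros LIMSEQ_ignore_initial_segment[OF lim_1_over_n])
    ultimately have "\<forall>\<^sub>F n in sequentially. max \<bar>fst z\<bar> \<bar>snd z\<bar> < 1 - 1 / real (n + 2)"
      by (auto simp only: order_tendstoD diff_0_right)
    then have "\<forall>\<^sub>F n in sequentially. indicat_real (?K n) z *\<^sub>R g z = indicat_real Omega z *\<^sub>R g z"
    proof eventually_elim
      case (elim n)
      then have "\<bar>fst z\<bar> < 1 - 1 / real (n + 2)" "\<bar>snd z\<bar> < 1 - 1 / real (n + 2)" by linarith+
      then have "z \<in> ?K n" by (cases z) (auto simp del: of_nat_add)
      with True show ?case by (simp del: of_nat_add)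
    qed
    then show ?thesis by (rule tendsto_eventually)
  next
    case False
    have "{-r..r} \<times> {-r..r} \<subseteq> Omega" if "r < 1" for r
      using that by (auto simp: Omega_def)
    from this[of "1 - 1 / real (n + 2)" for n] have "?K n \<subseteq> Omega" for n
      by (simp del: of_nat_add)
    with False have "z \<notin> ?K n" for n by blast
    with False show ?thesis by (simp del: of_nat_add mem_Times_iff)
  qed
qed

subsection \<open>Integration by parts in the convection term\<close>

text \<open>Fubini with the \<open>x\<close>-integral inside: for almost every \<open>y\<close> the
  section is integrable and \<open>y\<close> avoids the finite set \<open>Y\<close>. On such a line
  the fundamental theorem, with exceptional set \<open>X\<close>, gives F(1, y) - F(-1, y) =
  0.\<close>

lemma integral_x_derivative_eq_0:
  fixes F f :: "real \<times> real \<Rightarrow> real"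
  assumes fin: "finite X" "finite Y" and cont: "continuous_on (closure Omega) F"
    and bdry: "\<And>y. \<bar>y\<bar> \<le> 1 \<Longrightarrow> F (-1, y) = 0" "\<And>y. \<bar>y\<bar> \<le> 1 \<Longrightarrow> F (1, y) = 0"
    and deriv: "\<And>x y. x \<in> {-1<..<1} - X \<Longrightarrow> y \<in> {-1<..<1} - Y \<Longrightarrow>
      ((\<lambda>s. F (s, y)) has_real_derivative f (x, y)) (at x)"
    and int: "set_integrable lborel Omega f"
  shows "(LINT z:Omega|lborel. f z) = 0"
proof -
  let ?f = "\<lambda>x y. indicat_real Omega (x, y) *\<^sub>R f (x, y)"
  have split: "case_prod ?f = (\<lambda>z. indicat_real Omega z *\<^sub>R f z)" by auto
  have int': "integrable (lborel \<Otimes>\<^sub>M lborel) (case_prod ?f)"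
    using int unfolding lborel_prod split set_integrable_def .
  have "AE y in lborel. y \<notin> Y"
    using fin(2) by (intro AE_not_in finite_imp_null_set_lborel)
  with lborel_pair.AE_integrable_snd[OF int']
  have "AE y in lborel. (\<integral>x. ?f x y \<partial>lborel) = 0"
  proof eventually_elim
    case (elim y)
    show ?case
    proof (cases "y \<in> {-1<..<1}")
      case True
      have eq: "?f x y = indicator {-1<..<1} x *\<^sub>R f (x, y)" for x
        using True by (auto simp: Omega_def indicator_def)
      have si: "set_integrable lborel {-1<..<1} (\<lambda>x. f (x, y))"
        using elim(1) unfolding set_integrable_def eq .
      have "(\<integral>x. ?f x y \<partial>lborel) = (LINT x:{-1<..<1}|lborel. f (x, y))"
        unfolding set_lebesgue_integral_def eq ..
      also have "\<dots> = integral {-1<..<1} (\<lambda>x. f (x, y))"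
        using si by (rule set_borel_integral_eq_integral)
      also have "\<dots> = integral {-1..1} (\<lambda>x. f (x, y))"
        by (rule integral_open_interval_real[symmetric])
      also have "((\<lambda>x. f (x, y)) has_integral (F (1, y) - F (-1, y))) {-1..1}"
      proof (rule fundamental_theorem_of_calculus_interior_strong[OF fin(1)])
        show "((\<lambda>x. F (x, y)) has_vector_derivative f (x, y)) (at x)" if "x \<in> {-1<..<1} - X" for x
          using deriv[OF that, of y] True elim(2)
          by (simp add: has_real_derivative_iff_has_vector_derivative)
        show "continuous_on {-1..1} (\<lambda>x. F (x, y))"
          using True by (intro continuous_on_compose2[OF cont] continuous_intros)
            (auto simp: closure_Omega)
      qed simp
      then have "integral {-1..1} (\<lambda>x. f (x, y)) = F (1, y) - F (-1, y)"
        by (rule integral_unique)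
      finally show ?thesis using bdry[of y] True by (simp add: abs_le_iff)
    next
      case False
      then have eq: "?f x y = 0" for x by (auto simp: Omega_def)
      show ?thesis unfolding eq by simp
    qed
  qed
  then have "(\<integral>y. (\<integral>x. ?f x y \<partial>lborel) \<partial>lborel) = 0"
    by (rule integral_eq_zero_AE)
  then have "integral\<^sup>L lborel (case_prod ?f) = 0"
    using lborel_pair.integral_snd[OF int'] by (simp add: lborel_prod)
  then show ?thesis by (simp only: split set_lebesgue_integral_def)
qed

text \<open>Chain rule along s -> (s, y). The sets \<open>S\<close> and \<open>T\<close> allow both
  the whole plane and the closed square, where the derivative at x = -1 and x = 1 is
  one-sided.\<close>

lemma has_real_derivative_x_section:
  fixes f :: "real \<times> real \<Rightarrow> real"
  assumes "(f has_derivative blinfun_apply L) (at (x, y) within S)" "(\<lambda>s. (s, y)) ` T \<subseteq> S"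
  shows "((\<lambda>s. f (s, y)) has_real_derivative blinfun_apply L (1, 0)) (at x within T)"
proof -
  have "((\<lambda>s. (s, y)) has_derivative (\<lambda>h. (h, 0))) (at x within T)"
    by (rule has_derivative_Pair[OF has_derivative_ident has_derivative_const])
  from has_derivative_in_compose[OF this has_derivative_subset[OF assms]]
  have "((\<lambda>s. f (s, y)) has_derivative (\<lambda>h. blinfun_apply L (h, 0))) (at x within T)" .
  moreover have "(\<lambda>h. blinfun_apply L (h, 0)) = (*) (blinfun_apply L (1, 0))"
  proof
    fix h
    have "blinfun_apply L (h *\<^sub>R (1, 0)) = h *\<^sub>R blinfun_apply L (1, 0)"
      by (rule blinfun.scaleR_right)
    then show "blinfun_apply L (h, 0) = blinfun_apply L (1, 0) * h"
      by (simp add: mult.commute)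
  qed
  ultimately show ?thesis
    unfolding has_field_derivative_def by (rule back_subst)
qed

text \<open>The candidate \<open>g\<close> is the classical derivative off the exceptional lines and
  0 on them. Its weak identity says that the \<open>x\<close>-derivative of
  \<open>u * \<phi>\<close> has integral 0; continuity of \<open>u\<close> across the lines rules
  out extra terms.\<close>

lemma weak_x_derivative_of_piecewise_C1:
  fixes u :: "real \<times> real \<Rightarrow> real"
  assumes fin: "finite X" "finite Y" and cont: "continuous_on (closure Omega) u"
    and deriv: "\<And>x y. x \<in> {-1<..<1} - X \<Longrightarrow> y \<in> {-1<..<1} - Y \<Longrightarrow>
      \<exists>d. \<bar>d\<bar> \<le> M \<and> ((\<lambda>s. u (s, y)) has_real_derivative d) (at x)"
  obtains g K where "set_borel_measurable lborel Omega g" "\<And>z. \<bar>g z\<bar> \<le> K"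
    "\<And>x y. x \<in> {-1<..<1} - X \<Longrightarrow> y \<in> {-1<..<1} - Y \<Longrightarrow>
      ((\<lambda>s. u (s, y)) has_real_derivative g (x, y)) (at x)"
    "is_weak_derivative Omega (1, 0) u g"
proof -
  define D where "D = ({-1<..<1} - X) \<times> ({-1<..<1} - Y)"
  define g where "g z = (if z \<in> D then deriv (\<lambda>s. u (s, snd z)) (fst z) else 0)" for z
  have [measurable]: "D \<in> sets borel"
    unfolding D_def using fin
    by (intro borel_open open_Times open_Diff finite_imp_closed open_greaterThanLessThan)
  have D: "D \<subseteq> Omega" by (auto simp: D_def Omega_def)
  have g: "((\<lambda>s. u (s, y)) has_real_derivative g (x, y)) (at x) \<and> \<bar>g (x, y)\<bar> \<le> M"
    if "x \<in> {-1<..<1} - X" "y \<in> {-1<..<1} - Y" for x y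
    using deriv[OF that] that by (auto simp: g_def D_def DERIV_imp_deriv)
  \<comment> \<open>The maximum with 0 covers the default value off \<open>D\<close> without asking
    for the sign of \<open>M\<close>.\<close>
  have bound: "\<bar>g z\<bar> \<le> max M 0" for z
    using g[of "fst z" "snd z"] by (cases "z \<in> D") (force simp: D_def, simp add: g_def)
  \<comment> \<open>Values of \<open>u\<close> off the closed square are arbitrary, so difference
    quotients are formed with the extension by 0. For small steps the shifted point stays in the
    square and the extension is not seen.\<close>
  let ?U = "\<lambda>z. indicat_real (closure Omega) z *\<^sub>R u z"
  have [measurable]: "?U \<in> borel_measurable borel"
    using cont by (intro borel_measurable_continuous_on_indicator) auto
  have meas[measurable]: "g \<in> borel_measurable borel"
  proof (rule borel_measurable_LIMSEQ_real)
    let ?d = "\<lambda>n::nat. inverse (real (Suc n))"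
    let ?q = "\<lambda>n z. if z \<in> D then (?U (fst z + ?d n, snd z) - ?U z) / ?d n else 0"
    show "?q n \<in> borel_measurable borel" for n
    proof -
      have [measurable]: "(\<lambda>z::real\<times>real. (fst z + ?d n, snd z)) \<in> borel_measurable borel"
        by (intro borel_measurable_continuous_onI continuous_intros)
      show ?thesis by measurable
    qed
    show "(\<lambda>n. ?q n z) \<longlonglongrightarrow> g z" for z
    proof (cases "z \<in> D")
      case True
      obtain x y where z: "z = (x, y)" by (cases z)
      have xy: "x \<in> {-1<..<1} - X" "y \<in> {-1<..<1} - Y" using True by (auto simp: z D_def)
      have lim0: "(\<lambda>n. ?d n) \<longlonglongrightarrow> 0" by (rule LIMSEQ_inverse_real_of_nat)
      have "((\<lambda>h. (u (x + h, y) - u (x, y)) / h) \<longlongrightarrow> g z) (at 0)"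
        using g[OF xy] by (simp add: DERIV_def z)
      then have "(\<lambda>n. (u (x + ?d n, y) - u (x, y)) / ?d n) \<longlonglongrightarrow> g z"
        by (rule filterlim_compose) (use lim0 in \<open>simp add: filterlim_at\<close>)
      moreover have "\<forall>\<^sub>F n in sequentially. ?d n < 1 - x"
        using xy by (intro order_tendstoD(2)[OF lim0]) auto
      then have "\<forall>\<^sub>F n in sequentially. (u (x + ?d n, y) - u (x, y)) / ?d n = ?q n z"
      proof eventually_elim
        case (elim n)
        have "0 < ?d n" by simp
        moreover have "-1 < x" using xy by simp
        ultimately have "-1 \<le> x + ?d n" "x + ?d n \<le> 1" using elim by linarith+
        with xy have "(x + ?d n, y) \<in> closure Omega" "(x, y) \<in> closure Omega"
          by (auto simp: closure_Omega simp del: of_nat_Suc)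
        then show ?case using True by (simp add: z)
      qed
      ultimately show ?thesis by (rule Lim_transform_eventually)
    qed (simp add: g_def)
  qed
  have loc: "locally_integrable_on g Omega"
    unfolding locally_integrable_on_def
  proof (intro allI impI, elim conjE)
    fix K assume K: "compact K" "K \<subseteq> Omega"
    have "set_integrable lborel Omega (\<lambda>z. g z * 1)"
      using bound by (intro set_integrable_continuous_mult_bounded) (auto simp: set_borel_measurable_def)
    then have "set_integrable lborel Omega g" by simp
    then show "set_integrable lborel K g"
      by (rule set_integrable_subset) (use K in \<open>simp_all add: compact_imp_closed\<close>)
  qed
  have "(LINT z:Omega|lborel. u z * frechet_derivative \<phi> (at z) (1, 0)) = - (LINT z:Omega|lborel. g z * \<phi> z)"
    if \<phi>: "\<phi> \<in> test_functions Omega" for \<phi>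
  proof -
    obtain f' where f': "\<And>z. (\<phi> has_derivative blinfun_apply (f' z)) (at z)" "continuous_on UNIV f'"
      "\<And>z e. frechet_derivative \<phi> (at z) e = blinfun_apply (f' z) e"
      using test_functions_C1[OF \<phi>] by blast
    have \<phi>0: "\<phi> z = 0" if "z \<notin> Omega" for z using \<phi> that unfolding test_functions_def by blast
    have c\<phi>: "continuous_on (closure Omega) \<phi>" using \<phi> by (rule test_functions_continuous)
    have 1: "set_integrable lborel Omega (\<lambda>z. u z * blinfun_apply (f' z) (1, 0))"
      using cont continuous_on_subset[OF f'(2)]
      by (intro set_integrable_continuous_closure_Omega continuous_intros) auto
    have 2: "set_integrable lborel Omega (\<lambda>z. g z * \<phi> z)"
      using c\<phi> bound by (intro set_integrable_continuous_mult_bounded) (auto simp: set_borel_measurable_def)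
    have "(LINT z:Omega|lborel. u z * blinfun_apply (f' z) (1, 0) + g z * \<phi> z) = 0"
    proof (rule integral_x_derivative_eq_0[OF fin, where F = "\<lambda>z. u z * \<phi> z"])
      show "continuous_on (closure Omega) (\<lambda>z. u z * \<phi> z)"
        using cont c\<phi> by (intro continuous_intros)
      show "set_integrable lborel Omega (\<lambda>z. u z * blinfun_apply (f' z) (1, 0) + g z * \<phi> z)"
        using 1 2 by (rule set_integral_add)
      fix x y assume xy: "x \<in> {-1<..<1} - X" "y \<in> {-1<..<1} - Y"
      have "((\<lambda>s. \<phi> (s, y)) has_real_derivative blinfun_apply (f' (x, y)) (1, 0)) (at x)"
        by (rule has_real_derivative_x_section[OF f'(1)]) simp
      from DERIV_mult[OF g[OF xy, THEN conjunct1] this]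
      show "((\<lambda>s. u (s, y) * \<phi> (s, y)) has_real_derivative
          u (x, y) * blinfun_apply (f' (x, y)) (1, 0) + g (x, y) * \<phi> (x, y)) (at x)"
        by (simp add: mult.commute add.commute)
    qed (auto simp: \<phi>0 Omega_def)
    then show ?thesis using 1 2 by (simp add: set_integral_add f'(3))
  qed
  moreover have "locally_integrable_on u Omega"
    unfolding locally_integrable_on_def
    by (intro allI impI set_integrable_subset[OF set_integrable_continuous_closure_Omega[OF cont]])
      (simp_all add: compact_imp_closed)
  ultimately have "is_weak_derivative Omega (1, 0) u g"
    using loc by (auto simp: is_weak_derivative_def)
  moreover have "set_borel_measurable lborel Omega g"
    by (simp add: set_borel_measurable_def)
  ultimately show ?thesis
    using that[of g "max M 0"] g bound by blast
qed

lemma b1_pdx: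
  assumes "C1_on (closure Omega) a"
  shows "continuous_on (closure Omega) (b1 a)" "continuous_on (closure Omega) (pdx (b1 a))"
    "\<And>x y. (x, y) \<in> Omega \<Longrightarrow> ((\<lambda>s. b1 a (s, y)) has_real_derivative pdx (b1 a) (x, y)) (at x)"
proof -
  obtain a' where a': "\<And>z. z \<in> closure Omega \<Longrightarrow> (a has_derivative blinfun_apply (a' z)) (at z within closure Omega)"
    "continuous_on (closure Omega) a'"
    using assms by (auto simp: C1_on_def)
  have ca: "continuous_on (closure Omega) a"
    using assms by (rule C1_on_imp_continuous_on)
  have b1: "b1 a = (\<lambda>z. fst z * a z)" by (auto simp: b1_def)
  show "continuous_on (closure Omega) (b1 a)"
    unfolding b1 using ca by (intro continuous_intros)
  have D: "((\<lambda>s. b1 a (s, y)) has_real_derivative a (x, y) + x * blinfun_apply (a' (x, y)) (1, 0))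
      (at x within {-1..1})" if "(x, y) \<in> closure Omega" for x y
  proof -
    have "((\<lambda>s. a (s, y)) has_real_derivative blinfun_apply (a' (x, y)) (1, 0)) (at x within {-1..1})"
      using that by (intro has_real_derivative_x_section[OF a'(1)]) (auto simp: closure_Omega)
    from DERIV_mult[OF DERIV_ident this] show ?thesis
      unfolding b1 by (simp add: mult.commute add.commute)
  qed
  \<comment> \<open>Derivatives within a nondegenerate closed interval are unique, so
    \<open>vector_derivative\<close> returns the product-rule value at the end points too. The
    formula also shows continuity up to the boundary.\<close>
  have pdx: "pdx (b1 a) (x, y) = a (x, y) + x * blinfun_apply (a' (x, y)) (1, 0)"
    if "(x, y) \<in> closure Omega" for x y
  proof -
    have "x \<in> {-1..1}" using that by (simp add: closure_Omega)
    then show ?thesis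
      unfolding pdx_def prod.case
      using D[OF that] vector_derivative_within_closed_interval[of "-1" 1 x]
      by (simp add: has_real_derivative_iff_has_vector_derivative)
  qed
  have "continuous_on (closure Omega) (\<lambda>z. a z + fst z * blinfun_apply (a' z) (1, 0))"
    using ca a'(2) by (intro continuous_intros)
  then show "continuous_on (closure Omega) (pdx (b1 a))"
    by (rule continuous_on_eq) (auto simp: pdx)
  fix x y assume xy: "(x, y) \<in> Omega"
  with Omega_subset_closure have "(x, y) \<in> closure Omega" by auto
  moreover have "at x within {-1..1} = at x"
    using xy by (intro at_within_interior) (auto simp: Omega_def)
  ultimately show "((\<lambda>s. b1 a (s, y)) has_real_derivative pdx (b1 a) (x, y)) (at x)"
    using D[of x y] by (simp add: pdx)
qed

text \<open>The derivative of \<open>b1 a * G\<^sup>2\<close> in \<open>x\<close> has integral \<open>0\<close>.  As \<open>wdx\<close> is an arbitrary choice of a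
  weak derivative, it first has to be identified almost everywhere with the piecewise one.\<close>

lemma convection_term_integration_by_parts:
  assumes a: "C1_on (closure Omega) a"
    and fin: "finite X" "finite Y" and cont: "continuous_on (closure Omega) G"
    and bdry: "\<And>z. z \<in> frontier Omega \<Longrightarrow> G z = 0"
    and deriv: "\<And>x y. x \<in> {-1<..<1} - X \<Longrightarrow> y \<in> {-1<..<1} - Y \<Longrightarrow>
      \<exists>d. \<bar>d\<bar> \<le> M \<and> ((\<lambda>s. G (s, y)) has_real_derivative d) (at x)"
  shows "L2_inner (\<lambda>z. b1 a z * wdx G z) G = - (1 / 2) * (LINT z:Omega|lborel. pdx (b1 a) z * (G z)\<^sup>2)"
proof -
  obtain g K where g: "set_borel_measurable lborel Omega g" "\<And>z. \<bar>g z\<bar> \<le> K"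
    "\<And>x y. x \<in> {-1<..<1} - X \<Longrightarrow> y \<in> {-1<..<1} - Y \<Longrightarrow>
      ((\<lambda>s. G (s, y)) has_real_derivative g (x, y)) (at x)"
    "is_weak_derivative Omega (1, 0) G g"
    using weak_x_derivative_of_piecewise_C1[OF fin cont deriv] by blast
  note b = b1_pdx[OF a]
  have w: "is_weak_derivative Omega (1, 0) G (wdx G)"
    unfolding wdx_def using g(4) by (rule someI[of "is_weak_derivative Omega (1, 0) G"])
  have "set_borel_measurable lborel Omega (wdx G)"
    using w by (intro locally_integrable_on_Omega_measurable) (simp add: is_weak_derivative_def)
  then have m1: "(\<lambda>z. indicat_real Omega z *\<^sub>R wdx G z) \<in> borel_measurable lborel"
    by (simp add: set_borel_measurable_def)
  have m2: "(\<lambda>z. indicat_real Omega z *\<^sub>R (b1 a z * G z)) \<in> borel_measurable lborel"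
    using set_integrable_continuous_closure_Omega[OF continuous_on_mult[OF b(1) cont]]
    unfolding set_integrable_def by (rule borel_measurable_integrable)
  have int1: "set_integrable lborel Omega (\<lambda>z. g z * (b1 a z * G z))"
    using cont b g(1,2) by (intro set_integrable_continuous_mult_bounded continuous_intros)
  have int2: "set_integrable lborel Omega (\<lambda>z. pdx (b1 a) z * (G z)\<^sup>2)"
    using cont b by (intro set_integrable_continuous_closure_Omega continuous_intros)
  \<comment> \<open>The indicator is put on both factors because \<open>wdx G\<close> is known to be
    measurable on \<open>Omega\<close> only.\<close>
  have "L2_inner (\<lambda>z. b1 a z * wdx G z) G
      = (LINT z|lborel. (indicat_real Omega z *\<^sub>R wdx G z) * (indicat_real Omega z *\<^sub>R (b1 a z * G z)))"
    unfolding L2_inner_def set_lebesgue_integral_def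
    by (intro Bochner_Integration.integral_cong) (auto simp: indicator_def)
  also have "\<dots> = (LINT z|lborel. indicat_real Omega z *\<^sub>R (g z * (b1 a z * G z)))"
  proof (rule integral_cong_AE)
    show "AE z in lborel. (indicat_real Omega z *\<^sub>R wdx G z) * (indicat_real Omega z *\<^sub>R (b1 a z * G z))
        = indicat_real Omega z *\<^sub>R (g z * (b1 a z * G z))"
      using weak_derivative_unique_AE[OF w g(4)]
      by eventually_elim (auto simp: indicator_def)
    show "(\<lambda>z. (indicat_real Omega z *\<^sub>R wdx G z) * (indicat_real Omega z *\<^sub>R (b1 a z * G z)))
        \<in> borel_measurable lborel"
      using m1 m2 by (rule borel_measurable_times)
  qed (use int1 in \<open>simp add: set_integrable_def borel_measurable_integrable\<close>)
  finally have L: "L2_inner (\<lambda>z. b1 a z * wdx G z) G = (LINT z:Omega|lborel. g z * (b1 a z * G z))"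
    by (simp add: set_lebesgue_integral_def)
  have int1': "set_integrable lborel Omega (\<lambda>z. 2 * (g z * (b1 a z * G z)))"
    using int1 by (rule set_integrable_mult_right)
  have "(LINT z:Omega|lborel. pdx (b1 a) z * (G z)\<^sup>2 + 2 * (g z * (b1 a z * G z))) = 0"
  proof (rule integral_x_derivative_eq_0[OF fin, where F = "\<lambda>z. b1 a z * (G z)\<^sup>2"])
    show "continuous_on (closure Omega) (\<lambda>z. b1 a z * (G z)\<^sup>2)"
      using cont b by (intro continuous_intros)
    show "set_integrable lborel Omega (\<lambda>z. pdx (b1 a) z * (G z)\<^sup>2 + 2 * (g z * (b1 a z * G z)))"
      using int2 int1' by (rule set_integral_add)
    fix x y assume xy: "x \<in> {-1<..<1} - X" "y \<in> {-1<..<1} - Y"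
    then have "(x, y) \<in> Omega" by (auto simp: Omega_def)
    from DERIV_mult[OF b(3)[OF this] DERIV_power[OF g(3)[OF xy], of 2]]
    show "((\<lambda>s. b1 a (s, y) * (G (s, y))\<^sup>2) has_real_derivative
        pdx (b1 a) (x, y) * (G (x, y))\<^sup>2 + 2 * (g (x, y) * (b1 a (x, y) * G (x, y)))) (at x)"
      by (simp add: mult_ac)
  qed (auto intro!: bdry frontier_OmegaI)
  then have "(LINT z:Omega|lborel. pdx (b1 a) z * (G z)\<^sup>2) + 2 * (LINT z:Omega|lborel. g z * (b1 a z * G z)) = 0"
    using set_integral_add(2)[OF int2 int1'] by simp
  then show ?thesis using L by simp
qed

subsection \<open>An inverse inequality for bilinear functions\<close>

text \<open>In terms of the end values p and q of the affine function, the integral is the interval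
  length times (p^2 + p q + q^2) / 3. The antiderivative is expanded in powers of \<open>t\<close>,
  so \<open>B = 0\<close> needs no separate case.\<close>

lemma integral_affine_square:
  fixes A B u w :: real
  assumes "u \<le> w"
  shows "((\<lambda>t. (A + B * t)\<^sup>2) has_integral
    (w - u) * ((A + B * u)\<^sup>2 + (A + B * u) * (A + B * w) + (A + B * w)\<^sup>2) / 3) {u..w}"
proof -
  let ?P = "\<lambda>t. A\<^sup>2 * t + A * B * t^2 + B\<^sup>2 * t^3 / 3"
  have "((\<lambda>t. (A + B * t)\<^sup>2) has_integral (?P w - ?P u)) {u..w}"
    using assms
    by (intro fundamental_theorem_of_calculus)
      (auto intro!: derivative_eq_intros simp: has_real_derivative_iff_has_vector_derivative[symmetric]
        power2_eq_square algebra_simps)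
  moreover have "?P w - ?P u = (w - u) * ((A + B * u)\<^sup>2 + (A + B * u) * (A + B * w) + (A + B * w)\<^sup>2) / 3"
    by (simp add: power2_eq_square power3_eq_cube field_simps)
  ultimately show ?thesis by simp
qed

text \<open>The difference of the two sides is (p + 2 q)^2 / 12 for \<open>e = p\<close>, and
  symmetrically for \<open>e = q\<close>.\<close>

lemma square_average_ge:
  fixes p q :: real
  assumes "e \<in> {p, q}"
  shows "e\<^sup>2 / 4 \<le> (p\<^sup>2 + p * q + q\<^sup>2) / 3"
proof -
  have "0 \<le> (p + 2 * q)\<^sup>2" "0 \<le> (q + 2 * p)\<^sup>2" by simp_all
  with assms show ?thesis by (auto simp: power2_eq_square algebra_simps)
qed

text \<open>A bilinear function is affine in each variable. The one-dimensional bound in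
  \<open>y\<close>, for every fixed \<open>x\<close>, leaves the trace on the side
  \<open>y = ye\<close>; the same bound in \<open>x\<close> then leaves the corner value. Each use
  costs a factor 4.\<close>

lemma bilinear_inverse_inequality:
  fixes v :: "real \<times> real \<Rightarrow> real"
  assumes v: "bilinear_on ({x0..x1} \<times> {y0..y1}) v"
    and le: "x0 \<le> x1" "y0 \<le> y1" and e: "xe \<in> {x0, x1}" "ye \<in> {y0, y1}"
  shows "(x1 - x0) * (y1 - y0) / 16 * (v (xe, ye))\<^sup>2 \<le> integral (cbox (x0, y0) (x1, y1)) (\<lambda>z. (v z)\<^sup>2)"
proof -
  obtain p q r s where v: "\<And>x y. x \<in> {x0..x1} \<Longrightarrow> y \<in> {y0..y1} \<Longrightarrow> v (x, y) = p + q * x + r * y + s * x * y"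
    using v unfolding bilinear_on_def by force
  let ?P = "\<lambda>x y. p + q * x + r * y + s * x * y"
  let ?I = "\<lambda>x. (y1 - y0) * ((?P x y0)\<^sup>2 + ?P x y0 * ?P x y1 + (?P x y1)\<^sup>2) / 3"
  have "integral (cbox (x0, y0) (x1, y1)) (\<lambda>z. (v z)\<^sup>2)
      = integral (cbox (x0, y0) (x1, y1)) (\<lambda>z. (?P (fst z) (snd z))\<^sup>2)"
    by (rule integral_cong) (auto simp: cbox_Pair_eq v)
  also have "\<dots> = integral {x0..x1} (\<lambda>x. integral {y0..y1} (\<lambda>y. (?P x y)\<^sup>2))"
    by (subst integral_prod_continuous) (auto intro!: continuous_intros)
  also have "\<dots> = integral {x0..x1} ?I"
  proof (intro integral_cong integral_unique)
    fix x
    show "((\<lambda>y. (?P x y)\<^sup>2) has_integral ?I x) {y0..y1}"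
      using integral_affine_square[OF le(2), of "p + q * x" "r + s * x"] by (simp add: algebra_simps)
  qed
  finally have eq: "integral (cbox (x0, y0) (x1, y1)) (\<lambda>z. (v z)\<^sup>2) = integral {x0..x1} ?I" .
  have E: "((\<lambda>x. (y1 - y0) / 4 * (?P x ye)\<^sup>2) has_integral
     (y1 - y0) / 4 * ((x1 - x0) * ((?P x0 ye)\<^sup>2 + ?P x0 ye * ?P x1 ye + (?P x1 ye)\<^sup>2) / 3)) {x0..x1}"
    using integral_affine_square[OF le(1), of "p + r * ye" "q + s * ye"]
    by (intro has_integral_mult_right) (simp add: algebra_simps)
  have "(x1 - x0) * (y1 - y0) / 16 * (v (xe, ye))\<^sup>2 = (y1 - y0) / 4 * ((x1 - x0) * ((?P xe ye)\<^sup>2 / 4))"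
    using e le by (subst v) (auto simp: field_simps)
  also have "\<dots> \<le> (y1 - y0) / 4 * ((x1 - x0) * (((?P x0 ye)\<^sup>2 + ?P x0 ye * ?P x1 ye + (?P x1 ye)\<^sup>2) / 3))"
    using e le by (intro mult_left_mono square_average_ge) auto
  also have "\<dots> = integral {x0..x1} (\<lambda>x. (y1 - y0) / 4 * (?P x ye)\<^sup>2)"
    using integral_unique[OF E] by (simp only: times_divide_eq_right)
  also have "\<dots> \<le> integral {x0..x1} ?I"
  proof (rule integral_le)
    show "(\<lambda>x. (y1 - y0) / 4 * (?P x ye)\<^sup>2) integrable_on {x0..x1}"
      using E by (rule has_integral_integrable)
    show "?I integrable_on {x0..x1}"
      by (intro integrable_continuous_interval continuous_intros) auto
    fix x
    have "(y1 - y0) * ((?P x ye)\<^sup>2 / 4) \<le> (y1 - y0) * (((?P x y0)\<^sup>2 + ?P x y0 * ?P x y1 + (?P x y1)\<^sup>2) / 3)"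
      using e le by (intro mult_left_mono square_average_ge) auto
    then show "(y1 - y0) / 4 * (?P x ye)\<^sup>2 \<le> ?I x" by simp
  qed
  finally show ?thesis unfolding eq .
qed

subsection \<open>The mesh\<close>

lemma mesh_x_ends:
  assumes "4 \<le> N" "4 dvd N"
  shows "mesh_x N l 0 = -1" "mesh_x N l (2 * N) = 1"
proof -
  \<comment> \<open>Writing \<open>N\<close> as \<open>4 * k\<close> makes every \<open>div\<close>
    in the mesh definitions exact.\<close>
  obtain k where "N = 4 * k" "0 < k" using assms by (auto elim!: dvdE)
  then show "mesh_x N l 0 = -1" "mesh_x N l (2 * N) = 1"
    by (auto simp: mesh_x_def half_mesh_x_def)
qed

lemma mesh_y_ends:
  assumes "4 \<le> N" "4 dvd N"
  shows "mesh_y N l 0 = -1" "mesh_y N l N = 1"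
proof -
  obtain k where "N = 4 * k" "0 < k" using assms by (auto elim!: dvdE)
  then show "mesh_y N l 0 = -1" "mesh_y N l N = 1"
    by (simp_all add: mesh_y_def)
qed

text \<open>The least \<open>k\<close> with \<open>x < f k\<close> ends a step that crosses
  \<open>x\<close>; this works for any sequence, monotone or not.\<close>

lemma between_mesh_points:
  fixes f :: "nat \<Rightarrow> real"
  assumes "f 0 < x" "x < f n" "x \<notin> f ` {..n}"
  obtains i where "i < n" "f i < x" "x < f (Suc i)"
proof -
  define k where "k = (LEAST k. x < f k)"
  have k: "x < f k" "k \<le> n"
    unfolding k_def using assms(2) by (rule LeastI, rule Least_le)
  have nk: "\<not> x < f i" if "i < k" for i
    using that unfolding k_def by (rule not_less_Least)
  have "k \<noteq> 0" using k(1) assms(1) by (metis less_asym)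
  then obtain i where i: "k = Suc i" by (metis not0_implies_Suc)
  have "f i \<noteq> x" using assms(3) k(2) i by auto
  with nk[of i] i k show ?thesis by (intro that[of i]) auto
qed

text \<open>On a cell the \<open>x\<close>-derivative is \<open>q + s * y\<close>, at most
  \<bar>q\<bar> + \<bar>s\<bar> in modulus for \<bar>y\<bar> \<le> 1. There are finitely many cells,
  and the sum of these nonnegative bounds serves all of them.\<close>

lemma S_h_piecewise_x_derivative:
  assumes N: "4 \<le> N" "4 dvd N" and G: "G \<in> S_h N lx ly"
  obtains M where "\<And>x y. x \<in> {-1<..<1} - mesh_x N lx ` {..2 * N} \<Longrightarrow> y \<in> {-1<..<1} - mesh_y N ly ` {..N} \<Longrightarrow>
      \<exists>d. \<bar>d\<bar> \<le> M \<and> ((\<lambda>s. G (s, y)) has_real_derivative d) (at x)"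
proof -
  let ?B = "\<lambda>i j C. \<exists>p q r s. \<bar>q\<bar> + \<bar>s\<bar> = C \<and>
      (\<forall>(x, y)\<in>mesh_rect N lx ly i j. G (x, y) = p + q * x + r * y + s * x * y)"
  define C where "C i j = (SOME C. ?B i j C)" for i j
  have C: "?B i j (C i j)" if "i < 2 * N" "j < N" for i j
  proof -
    have "\<exists>C. ?B i j C"
      using G that unfolding S_h_def bilinear_on_def by blast
    then show ?thesis unfolding C_def by (rule someI_ex)
  qed
  define M where "M = (\<Sum>i<2 * N. \<Sum>j<N. C i j)"
  have C0: "0 \<le> C i j" if "i < 2 * N" "j < N" for i j
    using C[OF that] by force
  show ?thesis
  proof (rule that[of M])
    fix x y assume x: "x \<in> {-1<..<1} - mesh_x N lx ` {..2 * N}" and y: "y \<in> {-1<..<1} - mesh_y N ly ` {..N}"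
    obtain i where i: "i < 2 * N" "mesh_x N lx i < x" "x < mesh_x N lx (Suc i)"
      using x between_mesh_points[of "mesh_x N lx" x "2 * N"] mesh_x_ends[OF N] by auto
    obtain j where j: "j < N" "mesh_y N ly j < y" "y < mesh_y N ly (Suc j)"
      using y between_mesh_points[of "mesh_y N ly" y N] mesh_y_ends[OF N] by auto
    obtain p q r s where qs: "\<bar>q\<bar> + \<bar>s\<bar> = C i j"
      and G': "\<forall>(x, y)\<in>mesh_rect N lx ly i j. G (x, y) = p + q * x + r * y + s * x * y"
      using C[OF i(1) j(1)] by blast
    have "((\<lambda>x. p + q * x + r * y + s * x * y) has_real_derivative q + s * y) (at x)"
      by (auto intro!: derivative_eq_intros)
    then have "((\<lambda>s. G (s, y)) has_real_derivative q + s * y) (at x)"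
    proof (rule has_field_derivative_transform_within_open[where S = "{mesh_x N lx i<..<mesh_x N lx (Suc i)}"])
      fix t assume "t \<in> {mesh_x N lx i<..<mesh_x N lx (Suc i)}"
      with j have "(t, y) \<in> mesh_rect N lx ly i j" by (auto simp: mesh_rect_def)
      with G' show "p + q * t + r * y + s * t * y = G (t, y)" by auto
    qed (use i in auto)
    moreover have "\<bar>q + s * y\<bar> \<le> M"
    proof -
      have "\<bar>s * y\<bar> \<le> \<bar>s\<bar>" using y by (auto simp: abs_mult intro!: mult_left_le)
      then have "\<bar>q + s * y\<bar> \<le> C i j" using qs by linarith
      also have "\<dots> \<le> (\<Sum>j<N. C i j)"
        using i(1) j(1) C0 by (intro member_le_sum) auto
      also have "\<dots> \<le> M" unfolding M_def
        using i(1) C0 by (intro member_le_sum[of i "{..<2 * N}" "\<lambda>i. \<Sum>j<N. C i j"] sum_nonneg) auto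
      finally show ?thesis .
    qed
    ultimately show "\<exists>d. \<bar>d\<bar> \<le> M \<and> ((\<lambda>s. G (s, y)) has_real_derivative d) (at x)" by blast
  qed
qed

text \<open>A mesh point to the right of \<open>l > 0\<close> has index at least N + N/2, where the
  spacing is (1 - l) / (N/2); \<open>l \<le> 1 / 2\<close> makes this at least 1 / N.\<close>

lemma coarse_mesh_x:
  assumes N: "4 \<le> N" "4 dvd N" and l: "0 < l" "l \<le> 1 / 2"
    and m: "m < 2 * N" "l \<le> mesh_x N l m"
  shows "mesh_x N l (Suc m) - mesh_x N l m \<ge> 1 / real N" "mesh_x N l (Suc m) \<le> 1"
proof -
  obtain k where k: "N = 4 * k" "0 < k" using N by (auto elim!: dvdE)
  have mN: "N \<le> m"
  proof (rule ccontr)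
    assume "\<not> N \<le> m"
    then have "N - m \<le> N" "mesh_x N l m = - half_mesh_x N l (N - m)" by (auto simp: mesh_x_def)
    moreover have "0 \<le> half_mesh_x N l (N - m)"
      using l k by (auto simp: half_mesh_x_def intro!: add_nonneg_nonneg mult_nonneg_nonneg divide_nonneg_nonneg)
    ultimately show False using m l by simp
  qed
  define i where "i = m - N"
  have m': "m = N + i" using mN by (simp add: i_def)
  have i: "2 * k \<le> i"
  proof (rule ccontr)
    assume *: "\<not> 2 * k \<le> i"
    then have "mesh_x N l m = real i * (l / (2 * real k))" by (simp add: m' mesh_x_def half_mesh_x_def k)
    also have "\<dots> < 2 * real k * (l / (2 * real k))"
      using * l k by (intro mult_strict_right_mono) auto
    also have "\<dots> = l" using k by simp
    finally show False using m by simp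
  qed
  \<comment> \<open>At \<open>j = 2 * k\<close> the definition uses its fine branch; both formulas
    give \<open>l\<close> there.\<close>
  have val: "mesh_x N l (N + j) = l + (real j - 2 * real k) * ((1 - l) / (2 * real k))" if "2 * k \<le> j" for j
    using that k by (cases "j = 2 * k") (auto simp: mesh_x_def half_mesh_x_def)
  have "mesh_x N l (Suc m) - mesh_x N l m = (1 - l) / (2 * real k)"
    using val[of i] val[of "Suc i"] i by (simp add: m' algebra_simps diff_divide_distrib add_divide_distrib)
  also have "\<dots> \<ge> 1 / real N" using l k by (simp add: field_simps)
  finally show "mesh_x N l (Suc m) - mesh_x N l m \<ge> 1 / real N" .
  have "mesh_x N l (Suc m) = l + (real (Suc i) - 2 * real k) * ((1 - l) / (2 * real k))"
    using val[of "Suc i"] i by (simp add: m')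
  also have "\<dots> \<le> l + (2 * real k) * ((1 - l) / (2 * real k))"
    using m(1) l k by (intro add_left_mono mult_right_mono) (auto simp: m')
  also have "\<dots> = 1" using k by simp
  finally show "mesh_x N l (Suc m) \<le> 1" .
qed

lemma coarse_mesh_y:
  assumes N: "4 \<le> N" "4 dvd N" and l: "0 < l" "l \<le> 1 / 4"
    and n: "n < N" "- 1 + l \<le> mesh_y N l n" "mesh_y N l n \<le> 1 - l"
  obtains j where "j < N" "n = j \<or> n = Suc j" "-1 \<le> mesh_y N l j" "mesh_y N l (Suc j) \<le> 1"
    "mesh_y N l (Suc j) - mesh_y N l j \<ge> 1 / real N"
proof -
  obtain k where k: "N = 4 * k" "0 < k" using N by (auto elim!: dvdE)
  have n1: "k \<le> n"
  proof (rule ccontr)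
    assume *: "\<not> k \<le> n"
    then have "mesh_y N l n = - 1 + real n * (l / real k)" by (simp add: mesh_y_def k)
    also have "\<dots> < - 1 + real k * (l / real k)"
      using * l k by (intro add_strict_left_mono mult_strict_right_mono) auto
    also have "\<dots> = - 1 + l" using k by simp
    finally show False using n by simp
  qed
  have n2: "n \<le> 3 * k"
  proof (rule ccontr)
    assume *: "\<not> n \<le> 3 * k"
    then have "mesh_y N l n = 1 - l + (real n - 3 * real k) * (l / real k)" by (simp add: mesh_y_def k)
    moreover have "0 < (real n - 3 * real k) * (l / real k)"
      using * l k by (intro mult_pos_pos) auto
    ultimately show False using n by simp
  qed
  have val: "mesh_y N l j = - 1 + l + (real j - real k) * ((1 - l) / real k)" if "k \<le> j" "j \<le> 3 * k" for j
    using that k by (cases "j = k") (auto simp: mesh_y_def field_simps)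
  \<comment> \<open>Above the transition index \<open>3 * k\<close> the cells are fine, so there the
    coarse cell below is taken.\<close>
  define j where "j = (if n < 3 * k then n else n - 1)"
  have j: "k \<le> j" "Suc j \<le> 3 * k" "n = j \<or> n = Suc j" using n1 n2 k by (auto simp: j_def)
  have "mesh_y N l (Suc j) - mesh_y N l j = (1 - l) / real k"
    using val[of j] val[of "Suc j"] j by (simp add: algebra_simps diff_divide_distrib add_divide_distrib)
  also have "\<dots> \<ge> 1 / real N" using l k by (simp add: field_simps)
  finally have 1: "mesh_y N l (Suc j) - mesh_y N l j \<ge> 1 / real N" .
  have "0 \<le> (real j - real k) * ((1 - l) / real k)"
    using j l k by (intro mult_nonneg_nonneg) auto
  then have 2: "-1 \<le> mesh_y N l j" using val[of j] j l by simp
  have "mesh_y N l (Suc j) = - 1 + l + (real (Suc j) - real k) * ((1 - l) / real k)"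
    using val[of "Suc j"] j by simp
  also have "\<dots> \<le> - 1 + l + (2 * real k) * ((1 - l) / real k)"
    using j l k by (intro add_left_mono mult_right_mono) auto
  also have "\<dots> = 1 - l" using k by (simp add: field_simps)
  finally have 3: "mesh_y N l (Suc j) \<le> 1" using l by simp
  show ?thesis using that[of j] 1 2 3 j k by auto
qed

subsection \<open>Coercivity and the bound on the Green's function\<close>

text \<open>Valid for every \<open>f\<close>, hence also for the chosen representatives
  \<open>wdx G\<close> and \<open>wdy G\<close>: a non-integrable square has integral 0 by
  convention.\<close>

lemma L2_inner_self_nonneg: "0 \<le> L2_inner f f"
  unfolding L2_inner_def set_lebesgue_integral_def by (rule integral_nonneg_AE) auto

text \<open>On the diagonal, convection and reaction combine to the integral of (c - 1/2
  \<open>pdx (b1 a)\<close>) G^2, at least \<gamma> times the squared L^2 norm. The gradient part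
  has weight 1, whence the minimum.\<close>

lemma B_form_coercive:
  assumes a: "C1_on (closure Omega) a" and c: "C1_on (closure Omega) c"
    and \<gamma>: "\<And>z. z \<in> closure Omega \<Longrightarrow> c z - 1 / 2 * pdx (b1 a) z \<ge> \<gamma>"
    and N: "4 \<le> N" "4 dvd N" and G: "G \<in> S_h N lx ly" and \<epsilon>: "0 < \<epsilon>"
  shows "min 1 \<gamma> * (energy_norm \<epsilon> G)\<^sup>2 \<le> B_form \<epsilon> a c G G"
proof -
  have cont: "continuous_on (closure Omega) G" and bdry: "\<And>z. z \<in> frontier Omega \<Longrightarrow> G z = 0"
    using G by (auto simp: S_h_def)
  have cc: "continuous_on (closure Omega) c"
    using c by (rule C1_on_imp_continuous_on)
  obtain M where M: "\<And>x y. x \<in> {-1<..<1} - mesh_x N lx ` {..2 * N} \<Longrightarrow> y \<in> {-1<..<1} - mesh_y N ly ` {..N} \<Longrightarrow>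
      \<exists>d. \<bar>d\<bar> \<le> M \<and> ((\<lambda>s. G (s, y)) has_real_derivative d) (at x)"
    using S_h_piecewise_x_derivative[OF N G] by metis
  have conv: "L2_inner (\<lambda>z. b1 a z * wdx G z) G = - (1 / 2) * (LINT z:Omega|lborel. pdx (b1 a) z * (G z)\<^sup>2)"
    by (rule convection_term_integration_by_parts[OF a _ _ cont bdry M]) auto
  have i1: "set_integrable lborel Omega (\<lambda>z. c z * (G z)\<^sup>2)"
    using cont cc by (intro set_integrable_continuous_closure_Omega continuous_intros)
  have i2: "set_integrable lborel Omega (\<lambda>z. 1 / 2 * (pdx (b1 a) z * (G z)\<^sup>2))"
    using cont b1_pdx(2)[OF a] by (intro set_integrable_continuous_closure_Omega continuous_intros)
  have i3: "set_integrable lborel Omega (\<lambda>z. \<gamma> * (G z)\<^sup>2)"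
    using cont by (intro set_integrable_continuous_closure_Omega continuous_intros)
  have "\<gamma> * L2_inner G G = (LINT z:Omega|lborel. \<gamma> * (G z)\<^sup>2)"
    by (simp add: L2_inner_def power2_eq_square)
  also have "\<dots> \<le> (LINT z:Omega|lborel. c z * (G z)\<^sup>2 - 1 / 2 * (pdx (b1 a) z * (G z)\<^sup>2))"
  proof (rule set_integral_mono[OF i3 set_integral_diff(1)[OF i1 i2]])
    fix z assume "z \<in> Omega"
    then have "\<gamma> \<le> c z - 1 / 2 * pdx (b1 a) z" using Omega_subset_closure by (intro \<gamma>) blast
    then have "\<gamma> * (G z)\<^sup>2 \<le> (c z - 1 / 2 * pdx (b1 a) z) * (G z)\<^sup>2" by (rule mult_right_mono) simp
    then show "\<gamma> * (G z)\<^sup>2 \<le> c z * (G z)\<^sup>2 - 1 / 2 * (pdx (b1 a) z * (G z)\<^sup>2)"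
      by (simp add: algebra_simps)
  qed
  also have "\<dots> = (LINT z:Omega|lborel. c z * (G z)\<^sup>2) - 1 / 2 * (LINT z:Omega|lborel. pdx (b1 a) z * (G z)\<^sup>2)"
    unfolding set_integral_diff(2)[OF i1 i2] set_integral_mult_right ..
  also have "\<dots> = L2_inner (\<lambda>z. b1 a z * wdx G z) G + L2_inner (\<lambda>z. c z * G z) G"
    unfolding conv by (simp add: L2_inner_def power2_eq_square mult.assoc)
  finally have low: "\<gamma> * L2_inner G G \<le> L2_inner (\<lambda>z. b1 a z * wdx G z) G + L2_inner (\<lambda>z. c z * G z) G" .
  have g0: "0 \<le> \<epsilon> * grad_inner G G"
    using \<epsilon> L2_inner_self_nonneg by (auto simp: grad_inner_def)
  then have "(energy_norm \<epsilon> G)\<^sup>2 = \<epsilon> * grad_inner G G + L2_inner G G"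
    unfolding energy_norm_def using L2_inner_self_nonneg[of G] by simp
  then have "min 1 \<gamma> * (energy_norm \<epsilon> G)\<^sup>2 = min 1 \<gamma> * (\<epsilon> * grad_inner G G) + min 1 \<gamma> * L2_inner G G"
    by (simp add: algebra_simps)
  also have "\<dots> \<le> 1 * (\<epsilon> * grad_inner G G) + \<gamma> * L2_inner G G"
    using g0 L2_inner_self_nonneg[of G] by (intro add_mono mult_right_mono) auto
  finally show ?thesis using low by (simp add: B_form_def)
qed

text \<open>Both sides of a mesh rectangle in the coarse region have length at least \<open>1 / N\<close>; a source point on
  the upper boundary of that region is a corner of the rectangle below it.\<close>

lemma coarse_point_value_bound:
  assumes N: "4 \<le> N" "4 dvd N" and lx: "0 < lx" "lx \<le> 1 / 2" and ly: "0 < ly" "ly \<le> 1 / 4"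
    and mn: "m < 2 * N" "n < N" "(mesh_x N lx m, mesh_y N ly n) \<in> Omega_c lx ly"
    and v: "v \<in> S_h N lx ly"
  shows "(v (mesh_x N lx m, mesh_y N ly n))\<^sup>2 \<le> 16 * (real N)\<^sup>2 * L2_inner v v"
proof -
  let ?x = "mesh_x N lx" and ?y = "mesh_y N ly"
  have c: "lx \<le> ?x m" "-1 + ly \<le> ?y n" "?y n \<le> 1 - ly"
    using mn(3) by (auto simp: Omega_c_def)
  note mx = coarse_mesh_x[OF N lx mn(1) c(1)]
  obtain j where j: "j < N" "n = j \<or> n = Suc j" "-1 \<le> ?y j" "?y (Suc j) \<le> 1"
    "?y (Suc j) - ?y j \<ge> 1 / real N"
    using coarse_mesh_y[OF N ly mn(2) c(2,3)] by blast
  let ?T = "cbox (?x m, ?y j) (?x (Suc m), ?y (Suc j))"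
  have N0: "0 < 1 / real N" using N by simp
  then have le: "?x m \<le> ?x (Suc m)" "?y j \<le> ?y (Suc j)"
    using mx(1) j(5) by linarith+
  have cont: "continuous_on (closure Omega) v" using v by (simp add: S_h_def)
  have T: "?T \<subseteq> closure Omega"
    using c lx mx j by (auto simp: cbox_Pair_eq closure_Omega)
  have "bilinear_on ({?x m..?x (Suc m)} \<times> {?y j..?y (Suc j)}) v"
    using v mn(1) j(1) by (auto simp: S_h_def mesh_rect_def)
  then have "(?x (Suc m) - ?x m) * (?y (Suc j) - ?y j) / 16 * (v (?x m, ?y n))\<^sup>2 \<le> integral ?T (\<lambda>z. (v z)\<^sup>2)"
    by (rule bilinear_inverse_inequality) (use le j(2) in auto)
  also have "\<dots> \<le> integral (closure Omega) (\<lambda>z. (v z)\<^sup>2)"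
  proof (rule integral_subset_le[OF T])
    show "(\<lambda>z. (v z)\<^sup>2) integrable_on closure Omega"
      unfolding closure_Omega_cbox using cont
      by (intro integrable_continuous continuous_intros) (simp add: closure_Omega_cbox)
    show "(\<lambda>z. (v z)\<^sup>2) integrable_on ?T"
      using continuous_on_subset[OF cont T] by (intro integrable_continuous continuous_intros)
  qed simp
  \<comment> \<open>Passing from the closed to the open square drops only the boundary and leads to
    the set integral in \<open>L2_inner\<close>.\<close>
  also have "\<dots> = integral Omega (\<lambda>z. (v z)\<^sup>2)"
    unfolding closure_Omega_cbox unfolding Omega_eq_box by (rule integral_open_interval[symmetric])
  also have "\<dots> = L2_inner v v"
    unfolding L2_inner_def power2_eq_square
    by (rule set_borel_integral_eq_integral(2)[symmetric])
      (intro set_integrable_continuous_closure_Omega continuous_intros cont)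
  finally have 1: "(?x (Suc m) - ?x m) * (?y (Suc j) - ?y j) / 16 * (v (?x m, ?y n))\<^sup>2 \<le> L2_inner v v" .
  have "1 / real N * (1 / real N) \<le> (?x (Suc m) - ?x m) * (?y (Suc j) - ?y j)"
    using mx(1) j(5) le by (intro mult_mono) auto
  then have "1 / real N * (1 / real N) / 16 * (v (?x m, ?y n))\<^sup>2
      \<le> (?x (Suc m) - ?x m) * (?y (Suc j) - ?y j) / 16 * (v (?x m, ?y n))\<^sup>2"
    by (intro mult_right_mono divide_right_mono) auto
  with 1 have "1 / real N * (1 / real N) / 16 * (v (?x m, ?y n))\<^sup>2 \<le> L2_inner v v" by linarith
  then show ?thesis using N by (simp add: field_simps power2_eq_square)
qed

theorem lemma3p1:
  fixes a c :: "real \<times> real \<Rightarrow> real" and \<alpha> \<beta> \<gamma> :: real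
  assumes "C1_on (closure Omega) a" and "C1_on (closure Omega) c"
    and "\<alpha> \<ge> 5 / 2" and "\<gamma> > 0" and "2 / 3 \<le> \<beta>" and "\<beta> \<le> 1"
    and "\<And>z. z \<in> closure Omega \<Longrightarrow> \<bar>a z\<bar> \<ge> \<alpha>"
    and "\<And>z. z \<in> closure Omega \<Longrightarrow> \<bar>c z\<bar> \<ge> 0"
    and "\<And>z. z \<in> closure Omega \<Longrightarrow> c z - 1 / 2 * pdx (b1 a) z \<ge> \<gamma>"
  shows "\<exists>C>0. \<forall>\<epsilon> N m n G.
           0 < \<epsilon> \<and> \<epsilon> < 1 \<and> 4 \<le> N \<and> 4 dvd N \<and>
           0 < m \<and> m < 2 * N \<and> 0 < n \<and> n < N \<and>
           (mesh_x N (lambda_x \<epsilon> \<alpha>) m, mesh_y N (lambda_y \<epsilon> \<beta>) n)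
             \<in> Omega_c (lambda_x \<epsilon> \<alpha>) (lambda_y \<epsilon> \<beta>) \<and>
           is_discrete_Green \<epsilon> a c N (lambda_x \<epsilon> \<alpha>) (lambda_y \<epsilon> \<beta>)
             (mesh_x N (lambda_x \<epsilon> \<alpha>) m, mesh_y N (lambda_y \<epsilon> \<beta>) n) G
           \<longrightarrow> energy_norm \<epsilon> G \<le> C * real N"
\<comment> \<open>The 4 is the square root of the 16 in the corner bound, and 1 / min 1 \<gamma>
  comes from coercivity.\<close>
proof (intro exI[of _ "4 / min 1 \<gamma>"] conjI allI impI; (elim conjE)?)
  show "0 < 4 / min 1 \<gamma>" using assms(4) by simp
  fix \<epsilon> :: real and N m n :: nat and G
  let ?lx = "lambda_x \<epsilon> \<alpha>" and ?ly = "lambda_y \<epsilon> \<beta>" and ?E = "energy_norm \<epsilon> G"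
  let ?p = "(mesh_x N ?lx m, mesh_y N ?ly n)"
  assume \<epsilon>: "0 < \<epsilon>" "\<epsilon> < 1" and N: "4 \<le> N" "4 dvd N" and mn: "m < 2 * N" "n < N" "?p \<in> Omega_c ?lx ?ly"
    and Green: "is_discrete_Green \<epsilon> a c N ?lx ?ly ?p G"
  have G: "G \<in> S_h N ?lx ?ly" and B: "B_form \<epsilon> a c G G = G ?p"
    using Green by (auto simp: is_discrete_Green_def)
  \<comment> \<open>As \<epsilon> < 1, both logarithms are positive, and so are the transition
    points; their upper bounds are the caps in the minima.\<close>
  have lx: "0 < ?lx" "?lx \<le> 1 / 2"
    using \<epsilon> assms(3) by (auto simp: lambda_x_def)
  have "\<epsilon> powr (3 / 2) < 1" using \<epsilon> powr_less_mono2[of "3 / 2" \<epsilon> 1] by simp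
  then have ly: "0 < ?ly" "?ly \<le> 1 / 4"
    using \<epsilon> assms(5) by (auto simp: lambda_y_def)
  have g0: "0 \<le> \<epsilon> * grad_inner G G"
    using \<epsilon> L2_inner_self_nonneg by (auto simp: grad_inner_def)
  then have E2: "?E\<^sup>2 = \<epsilon> * grad_inner G G + L2_inner G G" and E0: "0 \<le> ?E"
    unfolding energy_norm_def using L2_inner_self_nonneg[of G] by simp_all
  have L2_le: "L2_inner G G \<le> ?E\<^sup>2"
    using g0 E2 by linarith
  have "(G ?p)\<^sup>2 \<le> 16 * (real N)\<^sup>2 * L2_inner G G"
    by (rule coarse_point_value_bound[OF N lx ly mn G])
  also have "\<dots> \<le> 16 * (real N)\<^sup>2 * ?E\<^sup>2"
    using L2_le by (rule mult_left_mono) simp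
  also have "\<dots> = (4 * real N * ?E)\<^sup>2" by (simp add: power_mult_distrib)
  finally have "G ?p \<le> 4 * real N * ?E"
    by (rule power2_le_imp_le) (use E0 in simp)
  moreover have "min 1 \<gamma> * ?E\<^sup>2 \<le> G ?p"
    unfolding B[symmetric] by (rule B_form_coercive[OF assms(1,2,9) N G \<epsilon>(1)])
  ultimately have "(min 1 \<gamma> * ?E) * ?E \<le> (4 * real N) * ?E"
    unfolding power2_eq_square mult.assoc by (rule order_trans[rotated])
  have "min 1 \<gamma> * ?E \<le> 4 * real N"
  \<comment> \<open>One factor \<open>?E\<close> is cancelled, which requires it to be
    positive.\<close>
  proof (cases "?E = 0")
    case False
    with E0 have "0 < ?E" by linarith
    with \<open>(min 1 \<gamma> * ?E) * ?E \<le> (4 * real N) * ?E\<close> show ?thesis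
      by (rule mult_right_le_imp_le)
  qed simp
  then show "?E \<le> 4 / min 1 \<gamma> * real N"
    using assms(4) by (simp add: pos_le_divide_eq mult.commute)
qed

end
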